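(* Let $S\subset\mathbb{R}^3$ be a connected orientable $\mathcal{C}^2$ surface with unit normal $N$, and suppose that $S$ is not totally umbilic. Then $S$ has nonzero constant mean curvature if and only if there is some $r\in\mathbb{R}\setminus\{0\}$ such that the ball $B_r$ rolls isotropically from every nonumbilic point of $S$.
   Context: Surfaces and curvature. $S$ is a connected orientable $\mathcal{C}^2$ surface in $\mathbb{R}^3$ with chosen unit normal field $N$. Principal curvatures $\kappa_1,\kappa_2$ are taken with respect to $N$, with the sign convention that the normal curvature of a unit-speed curve $\gamma$ in $S$ is $\langle\gamma'',N\rangle$; the mean curvature is $(\kappa_1+\kappa_2)/2$; a point is umbilic if $\kappa_1=\kappa_2$ there, and $S$ is totally umbilic if all its points are umbilic. Curves are of class at least $\mathcal{C}^2$. The ball. For $p\in S$ and a real number $r\neq 0$ (possibly negative), $B_r$ is the ball of radius $|r|$ centered at $p+rN_p$. The object that actually rolls is its boundary sphere $\widetilde S=\partial B_r$, which is tangent to $S$ at $p$. Intersections between $B_r$ and $S$ are allowed. Rolling. Let $\gamma\colon[0,\ell]\to S$ be a unit-speed curve with $\gamma(0)=p$. A motion of $\widetilde S$ on $S$ along $\gamma$ is a smooth (it suffices: continuously differentiable in $t$) one-parameter family $f_t$, $t\in[0,\ell]$, of direct isometries $f_t(x)=A_tx+b_t$ of $\mathbb{R}^3$ with $f_0=\mathrm{id}$ such that $f_t(\widetilde S)$ is tangent to $S$ at $\gamma(t)$ for every $t$. Its instantaneous motion at $t$ is the vector field $X_t(x)=f_t'(f_t^{-1}(x))=Q_tx+v_t$,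 where the prime denotes the $t$-derivative, $Q_t=A_t'A_t^T$ is skew-symmetric and $v_t=b_t'-Q_tb_t$. The angular velocity $\omega_t$ is the vector with $Q_tx=\omega_t\times x$ for all $x$. The motion is rotational if for every $t$ one has $Q_t\neq 0$ and $X_t(\gamma(t))=0$. A rolling (without skidding or spinning) of $B_r$ on $S$ along $\gamma$ is a rotational motion such that $\omega_t$ is tangent to $S$ at $\gamma(t)$ for every $t$. For the purposes here it suffices that a rolling exists along an arbitrarily short initial subarc $\gamma|_{[0,\varepsilon]}$, $\varepsilon>0$. Speed. The speed of $B_r$ at time $t$ while rolling along $\gamma$ is the length $\left|\frac{d}{dt}f_t(p+rN_p)\right|$ of the velocity of its center; the initial speed is the speed at $t=0$. Isotropic rolling. $B_r$ rolls isotropically from $p$ if its initial speed while rolling along a unit-speed curve $\gamma$ with $\gamma(0)=p$ does not depend on the direction $v=\gamma'(0)\in T_pS$; i.e. there is a constant $\sigma$ (which may depend on $p$) such that for every unit vector $v\in T_pS$ and every unit-speed curve $\gamma$ in $S$ with $\gamma(0)=p$, $\gamma'(0)=v$, the ball $B_r$ rolls on $S$ along an initial subarc of $\gamma$, with initial speed $\sigma$. *)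

theory Defs
  imports "HOL-Analysis.Analysis"
begin

section \<open>Regularity\<close>

definition C2_on :: "('a::real_normed_vector \<Rightarrow> 'b::real_normed_vector) \<Rightarrow> 'a set \<Rightarrow> bool" where
  "C2_on f U \<longleftrightarrow>
     (\<exists>(f' :: 'a \<Rightarrow> 'a \<Rightarrow>\<^sub>L 'b) (f'' :: 'a \<Rightarrow> 'a \<Rightarrow>\<^sub>L ('a \<Rightarrow>\<^sub>L 'b)).
        (\<forall>x\<in>U. (f has_derivative blinfun_apply (f' x)) (at x)) \<and>
        (\<forall>x\<in>U. (f' has_derivative blinfun_apply (f'' x)) (at x)) \<and>
        continuous_on U f'')"

text \<open>Time derivative on \<open>{0..l}\<close>, one-sided at the two endpoints.\<close>

definition time_deriv :: "real \<Rightarrow> (real \<Rightarrow> 'a::real_normed_vector) \<Rightarrow> real \<Rightarrow> 'a" where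
  "time_deriv l g t = vector_derivative g (at t within {0..l})"

definition C1_upto :: "real \<Rightarrow> (real \<Rightarrow> 'a::real_normed_vector) \<Rightarrow> bool" where
  "C1_upto l g \<longleftrightarrow> g differentiable_on {0..l} \<and> continuous_on {0..l} (time_deriv l g)"

definition C2_upto :: "real \<Rightarrow> (real \<Rightarrow> 'a::real_normed_vector) \<Rightarrow> bool" where
  "C2_upto l g \<longleftrightarrow> C1_upto l g \<and> C1_upto l (time_deriv l g)"


section \<open>Surfaces\<close>

text \<open>Regular (embedded) surfaces of class \<open>C\<^sup>2\<close>, given by local parametrizations.\<close>

definition C2_surface :: "(real^3) set \<Rightarrow> bool" where
  "C2_surface S \<longleftrightarrow>
     (\<forall>p\<in>S. \<exists>(U :: (real^2) set) V \<phi> \<psi>.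
        open U \<and> open V \<and> p \<in> V \<and> C2_on \<phi> U \<and>
        homeomorphism U (S \<inter> V) \<phi> \<psi> \<and>
        (\<forall>u\<in>U. inj (frechet_derivative \<phi> (at u))))"

definition tangent_space :: "(real^3) set \<Rightarrow> real^3 \<Rightarrow> (real^3) set" where
  "tangent_space S p =
     {v. \<exists>e>0. \<exists>\<alpha>. \<alpha> C1_differentiable_on {-e<..<e} \<and> \<alpha> ` {-e<..<e} \<subseteq> S \<and>
           \<alpha> 0 = p \<and> (\<alpha> has_vector_derivative v) (at 0)}"

definition tangent_at :: "(real^3) set \<Rightarrow> (real^3) set \<Rightarrow> real^3 \<Rightarrow> bool" where
  "tangent_at S1 S2 q \<longleftrightarrow> q \<in> S1 \<and> q \<in> S2 \<and> tangent_space S1 q = tangent_space S2 q"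

definition unit_normal_field :: "(real^3) set \<Rightarrow> (real^3 \<Rightarrow> real^3) \<Rightarrow> bool" where
  "unit_normal_field S N \<longleftrightarrow>
     continuous_on S N \<and> (\<forall>q\<in>S. norm (N q) = 1 \<and> (\<forall>v\<in>tangent_space S q. N q \<bullet> v = 0))"

definition unit_speed_curve :: "(real^3) set \<Rightarrow> real \<Rightarrow> (real \<Rightarrow> real^3) \<Rightarrow> bool" where
  "unit_speed_curve S l \<gamma> \<longleftrightarrow>
     0 < l \<and> C2_upto l \<gamma> \<and> \<gamma> ` {0..l} \<subseteq> S \<and> (\<forall>t\<in>{0..l}. norm (time_deriv l \<gamma> t) = 1)"


section \<open>Curvature\<close>

text \<open>
  The normal curvatures at \<open>p\<close> are the numbers \<open>\<gamma>''(0) \<bullet> N p\<close>. On a \<open>C\<^sup>2\<close> surface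
  they depend only on \<open>\<gamma>'(0)\<close> (continuously), so the supremum and infimum below
  are a maximum and a minimum over the unit circle of the tangent plane: the principal curvatures.
\<close>

definition normal_curvatures :: "(real^3) set \<Rightarrow> (real^3 \<Rightarrow> real^3) \<Rightarrow> real^3 \<Rightarrow> real set" where
  "normal_curvatures S N p =
     {time_deriv l (time_deriv l \<gamma>) 0 \<bullet> N p | l \<gamma>. unit_speed_curve S l \<gamma> \<and> \<gamma> 0 = p}"

definition principal_curvature1 :: "(real^3) set \<Rightarrow> (real^3 \<Rightarrow> real^3) \<Rightarrow> real^3 \<Rightarrow> real" where
  "principal_curvature1 S N p = Sup (normal_curvatures S N p)"

definition principal_curvature2 :: "(real^3) set \<Rightarrow> (real^3 \<Rightarrow> real^3) \<Rightarrow> real^3 \<Rightarrow> real" where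
  "principal_curvature2 S N p = Inf (normal_curvatures S N p)"

definition mean_curvature :: "(real^3) set \<Rightarrow> (real^3 \<Rightarrow> real^3) \<Rightarrow> real^3 \<Rightarrow> real" where
  "mean_curvature S N p = (principal_curvature1 S N p + principal_curvature2 S N p) / 2"

definition umbilic :: "(real^3) set \<Rightarrow> (real^3 \<Rightarrow> real^3) \<Rightarrow> real^3 \<Rightarrow> bool" where
  "umbilic S N p \<longleftrightarrow> principal_curvature1 S N p = principal_curvature2 S N p"

definition totally_umbilic :: "(real^3) set \<Rightarrow> (real^3 \<Rightarrow> real^3) \<Rightarrow> bool" where
  "totally_umbilic S N \<longleftrightarrow> (\<forall>p\<in>S. umbilic S N p)"


section \<open>Rolling\<close>

definition ball_center :: "(real^3 \<Rightarrow> real^3) \<Rightarrow> real^3 \<Rightarrow> real \<Rightarrow> real^3" where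
  "ball_center N p r = p + r *\<^sub>R N p"

definition ball_surface :: "(real^3 \<Rightarrow> real^3) \<Rightarrow> real^3 \<Rightarrow> real \<Rightarrow> (real^3) set" where
  "ball_surface N p r = sphere (ball_center N p r) \<bar>r\<bar>"

text \<open>A one-parameter family of isometries is represented by its linear parts \<open>A t\<close> and its
  translation parts \<open>b t\<close>; only the values for \<open>t\<close> in \<open>{0..l}\<close> matter.\<close>

definition isom :: "(real \<Rightarrow> real^3^3) \<Rightarrow> (real \<Rightarrow> real^3) \<Rightarrow> real \<Rightarrow> real^3 \<Rightarrow> real^3" where
  "isom A b t x = A t *v x + b t"

definition motion_along ::
  "(real^3) set \<Rightarrow> (real^3) set \<Rightarrow> (real \<Rightarrow> real^3) \<Rightarrow> real \<Rightarrow>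
     (real \<Rightarrow> real^3^3) \<Rightarrow> (real \<Rightarrow> real^3) \<Rightarrow> bool" where
  "motion_along S' S \<gamma> l A b \<longleftrightarrow>
     C1_upto l A \<and> C1_upto l b \<and>
     (\<forall>t\<in>{0..l}. rotation_matrix (A t)) \<and>
     isom A b 0 = id \<and>
     (\<forall>t\<in>{0..l}. tangent_at (isom A b t ` S') S (\<gamma> t))"

definition spin_matrix :: "real \<Rightarrow> (real \<Rightarrow> real^3^3) \<Rightarrow> real \<Rightarrow> real^3^3" where
  "spin_matrix l A t = time_deriv l A t ** transpose (A t)"

definition instantaneous_motion ::
  "real \<Rightarrow> (real \<Rightarrow> real^3^3) \<Rightarrow> (real \<Rightarrow> real^3) \<Rightarrow> real \<Rightarrow> real^3 \<Rightarrow> real^3" where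
  "instantaneous_motion l A b t x =
     spin_matrix l A t *v x + (time_deriv l b t - spin_matrix l A t *v b t)"

text \<open>Well defined when \<open>A\<close> is a differentiable family of rotations, as then
  \<open>spin_matrix l A t\<close> is skew-symmetric.\<close>

definition angular_velocity :: "real \<Rightarrow> (real \<Rightarrow> real^3^3) \<Rightarrow> real \<Rightarrow> real^3" where
  "angular_velocity l A t = (THE w. \<forall>x. spin_matrix l A t *v x = cross3 w x)"

definition rotational ::
  "(real \<Rightarrow> real^3) \<Rightarrow> real \<Rightarrow> (real \<Rightarrow> real^3^3) \<Rightarrow> (real \<Rightarrow> real^3) \<Rightarrow> bool" where
  "rotational \<gamma> l A b \<longleftrightarrow>
     (\<forall>t\<in>{0..l}. spin_matrix l A t \<noteq> 0 \<and> instantaneous_motion l A b t (\<gamma> t) = 0)"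

text \<open>Rolling, without skidding or spinning, of the ball that touches \<open>S\<close> at \<open>\<gamma> 0\<close>.\<close>

definition rolling ::
  "(real^3) set \<Rightarrow> (real^3 \<Rightarrow> real^3) \<Rightarrow> real \<Rightarrow> (real \<Rightarrow> real^3) \<Rightarrow> real \<Rightarrow>
     (real \<Rightarrow> real^3^3) \<Rightarrow> (real \<Rightarrow> real^3) \<Rightarrow> bool" where
  "rolling S N r \<gamma> l A b \<longleftrightarrow>
     motion_along (ball_surface N (\<gamma> 0) r) S \<gamma> l A b \<and>
     rotational \<gamma> l A b \<and>
     (\<forall>t\<in>{0..l}. angular_velocity l A t \<in> tangent_space S (\<gamma> t))"

definition ball_speed ::
  "(real^3 \<Rightarrow> real^3) \<Rightarrow> real^3 \<Rightarrow> real \<Rightarrow> real \<Rightarrow>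
     (real \<Rightarrow> real^3^3) \<Rightarrow> (real \<Rightarrow> real^3) \<Rightarrow> real \<Rightarrow> real" where
  "ball_speed N p r l A b t = norm (time_deriv l (\<lambda>s. isom A b s (ball_center N p r)) t)"

definition rolls_isotropically ::
  "(real^3) set \<Rightarrow> (real^3 \<Rightarrow> real^3) \<Rightarrow> real \<Rightarrow> real^3 \<Rightarrow> bool" where
  "rolls_isotropically S N r p \<longleftrightarrow>
     (\<exists>\<sigma>. \<forall>v\<in>tangent_space S p. norm v = 1 \<longrightarrow>
        (\<forall>l \<gamma>. unit_speed_curve S l \<gamma> \<and> \<gamma> 0 = p \<and> time_deriv l \<gamma> 0 = v \<longrightarrow>
           (\<exists>\<epsilon> A b. 0 < \<epsilon> \<and> \<epsilon> \<le> l \<and> rolling S N r \<gamma> \<epsilon> A b \<and> ball_speed N p r \<epsilon> A b 0 = \<sigma>)))"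

text \<open>The explicit formula for \<^const>\<open>instantaneous_motion\<close> is the velocity at time \<open>t\<close> of the
  point of the moving body that is located at \<open>x\<close> at that time.\<close>

lemma instantaneous_motion_eq:
  assumes l: "0 < l" and t: "t \<in> {0..l}"
    and A: "C1_upto l A" and b: "C1_upto l b" and rot: "rotation_matrix (A t)"
  shows "instantaneous_motion l A b t x = time_deriv l (\<lambda>s. isom A b s (inv (isom A b t) x)) t"
proof -
  define y where "y = transpose (A t) *v (x - b t)"
  have orth: "A t ** transpose (A t) = mat 1" "transpose (A t) ** A t = mat 1"
    using rot by (auto simp: rotation_matrix_def orthogonal_matrix_def)
  have "inj (isom A b t)"
  proof (rule injI)
    fix u v assume "isom A b t u = isom A b t v"
    then have "transpose (A t) *v (A t *v u) = transpose (A t) *v (A t *v v)"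
      by (simp add: isom_def)
    then show "u = v" by (simp add: matrix_vector_mul_assoc orth del: transpose_matrix_vector)
  qed
  moreover have "isom A b t y = x"
    by (simp add: isom_def y_def matrix_vector_mul_assoc orth del: transpose_matrix_vector)
  ultimately have y: "inv (isom A b t) x = y"
    by (metis inv_f_f)
  have DA: "(A has_vector_derivative time_deriv l A t) (at t within {0..l})"
    and Db: "(b has_vector_derivative time_deriv l b t) (at t within {0..l})"
    using A b t unfolding C1_upto_def time_deriv_def differentiable_on_def
    by (auto simp: vector_derivative_works)
  have "bounded_linear (\<lambda>M::real^3^3. M *v y)"
    by (rule linear_conv_bounded_linear[THEN iffD1], rule linearI)
      (simp_all add: matrix_vector_mult_add_rdistrib scaleR_matrix_vector_assoc)
  from bounded_linear.has_vector_derivative[OF this DA]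
  have "((\<lambda>s. isom A b s y) has_vector_derivative time_deriv l A t *v y + time_deriv l b t)
          (at t within {0..l})"
    unfolding isom_def by (rule has_vector_derivative_add[OF _ Db])
  then have "time_deriv l (\<lambda>s. isom A b s y) t = time_deriv l A t *v y + time_deriv l b t"
    using l t unfolding time_deriv_def
    by (intro vector_derivative_within_closed_interval) auto
  then show ?thesis
    by (simp add: y instantaneous_motion_def spin_matrix_def y_def matrix_vector_mul_assoc
        matrix_vector_mult_diff_distrib del: transpose_matrix_vector)
qed

end

theory Submission
  imports Defs
begin

text \<open>When \<open>B\<^sub>r\<close> rolls along \<open>\<gamma>\<close>, tangency forces its centre to be at \<open>\<gamma> + r (N \<circ> \<gamma>)\<close>, so the speed at
\<open>p\<close> in the unit direction \<open>v\<close> is \<open>\<bar>v + r dN v\<bar> = \<bar>(I - r W) v\<bar>\<close>, where \<open>W = - dN\<close> is the shape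
operator (\<open>rolling_speed\<close>). Conversely, the position of the centre leaves only one candidate for the
angular velocity that is tangent to the surface, namely \<open>\<omega> = N \<times> (\<gamma>' + r (N \<circ> \<gamma>)') / r\<close>; the rotations
are then found by solving the linear differential equation \<open>A' = \<omega> \<times> A\<close>, and the resulting motion is a
rolling as long as \<open>\<omega> \<noteq> 0\<close> (\<open>rolling_exists\<close>).

Since \<open>W\<close> is self-adjoint, \<open>I - r W\<close> maps the unit circle of the tangent plane into a circle if and
only if \<open>\<bar>1 - r \<kappa>\<^sub>1\<bar> = \<bar>1 - r \<kappa>\<^sub>2\<bar>\<close>. At a nonumbilic point this says \<open>r (\<kappa>\<^sub>1 + \<kappa>\<^sub>2) = 2\<close>, that is,
\<open>r H = 1\<close>, and the common value \<open>\<bar>r (\<kappa>\<^sub>1 - \<kappa>\<^sub>2)\<bar> / 2\<close> is then positive, so that the ball does roll.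
Hence \<open>B\<^sub>r\<close> rolls isotropically from a nonumbilic point exactly when \<open>H = 1 / r\<close> there
(\<open>rolls_isotropically_iff\<close>), and one direction of the theorem follows with \<open>r = 1 / H\<close>.

For the other direction the umbilics have to be dealt with. If \<open>h \<noteq> 1 / r\<close> is a value of \<open>H\<close>, then by
continuity \<open>H\<close> avoids \<open>1 / r\<close> near every point of \<open>{H = h}\<close>, so all points nearby are umbilics. On an
open set of umbilics \<open>H\<close> is locally constant, hence \<open>{H = h}\<close> is open and closed in the connected
surface \<open>S\<close>, hence all of \<open>S\<close>, and \<open>S\<close> would be totally umbilic.

Local constancy is usually obtained by differentiating \<open>dN = - H dx\<close>, but on a \<open>C\<^sup>2\<close> surface \<open>H\<close> is
merely continuous. Instead, let \<open>e\<^sub>1, e\<^sub>2\<close> be an orthonormal basis of the tangent plane at \<open>p\<close> and project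
onto \<open>S\<close> along \<open>N p\<close>. In the coordinates \<open>x\<^sub>i = x \<bullet> e\<^sub>i\<close> the equation reads
\<open>d (N \<bullet> e\<^sub>i) = - H dx\<^sub>i\<close>. So \<open>N \<bullet> e\<^sub>1\<close>, and with it its derivative \<open>- H\<close>, is a function of \<open>x\<^sub>1\<close> alone;
for the same reason \<open>H\<close> is a function of \<open>x\<^sub>2\<close> alone, hence constant
(\<open>slope_constant_across\<close>, \<open>umbilic_neighbourhood_mean_curvature\<close>).

The projection along \<open>N p\<close> also extends \<open>N\<close> to a \<open>C\<^sup>1\<close> map on an open subset of space, with derivative \<open>L\<close>.
This extension (the locale \<open>surface_patch\<close>) carries all local computations: on tangent vectors \<open>L\<close> is
\<open>- W\<close>, and curves in \<open>S\<close> can be handled by the chain rule without lifting them to a parameter domain.\<close>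

section \<open>Differential calculus\<close>

text \<open>The mean value theorem for \<open>t \<mapsto> f (x + t h + s k) - f (x + t h)\<close> turns the second difference
into a first difference of \<open>f'\<close>, which is controlled by the differentiability of \<open>f'\<close> at \<open>x\<close>.\<close>

lemma second_difference:
  fixes f :: "'a::real_normed_vector \<Rightarrow> real"
    and f' :: "'a \<Rightarrow> 'a \<Rightarrow>\<^sub>L real" and f'' :: "'a \<Rightarrow>\<^sub>L ('a \<Rightarrow>\<^sub>L real)"
  assumes "open U" "x \<in> U"
    and df: "\<And>y. y \<in> U \<Longrightarrow> (f has_derivative f' y) (at y)"
    and ddf: "(f' has_derivative f'') (at x)"
    and "0 < e"
  shows "\<exists>d>0. \<forall>s. 0 < s \<and> s < d \<longrightarrow>
     \<bar>f (x + s *\<^sub>R h + s *\<^sub>R k) - f (x + s *\<^sub>R h) - f (x + s *\<^sub>R k) + f x - s\<^sup>2 * f'' k h\<bar> \<le> e * s\<^sup>2"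
proof -
  define m where "m = norm h + norm k + 1"
  have m: "m > 0" "norm h \<le> m" unfolding m_def by (auto intro: add_nonneg_pos)
  \<comment> \<open>two values of \<open>f'\<close> each contribute an error \<open>e' (s m) m\<close>, in total \<open>e s\<close>\<close>
  define e' where "e' = e / (2 * m * m)"
  have e': "e' > 0" using m \<open>0 < e\<close> by (simp add: e'_def)
  obtain d1 where d1: "d1 > 0" "\<And>y. norm (y - x) < d1 \<Longrightarrow>
      norm (f' y - f' x - f'' (y - x)) \<le> e' * norm (y - x)"
    using ddf e' unfolding has_derivative_at_alt by blast
  obtain d2 where d2: "d2 > 0" "ball x d2 \<subseteq> U"
    using assms(1,2) openE by blast
  show ?thesis
  proof (intro exI[of _ "min d1 d2 / m"] conjI allI impI)
    show "0 < min d1 d2 / m" using d1 d2 m by simp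
    fix s :: real assume s: "0 < s \<and> s < min d1 d2 / m"
    then have sm: "s * m < d1" "s * m < d2" using m by (auto simp: pos_less_divide_eq)
    have nb: "norm (t *\<^sub>R h + c *\<^sub>R k) \<le> s * m" if "0 \<le> t" "t \<le> s" "0 \<le> c" "c \<le> s" for t c
    proof -
      have "norm (t *\<^sub>R h + c *\<^sub>R k) \<le> t * norm h + c * norm k"
        using that by (metis norm_triangle_ineq norm_scaleR abs_of_nonneg)
      also have "\<dots> \<le> s * norm h + s * norm k"
        using that by (intro add_mono mult_right_mono) auto
      also have "\<dots> \<le> s * m" using s unfolding m_def by (simp add: algebra_simps)
      finally show ?thesis .
    qed
    have inU: "x + t *\<^sub>R h + c *\<^sub>R k \<in> U" if "0 \<le> t" "t \<le> s" "0 \<le> c" "c \<le> s" for t c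
    proof -
      have "dist x (x + t *\<^sub>R h + c *\<^sub>R k) = norm (t *\<^sub>R h + c *\<^sub>R k)"
        by (metis add.assoc add_diff_cancel_left' dist_norm dist_commute)
      then show ?thesis using nb[OF that] sm(2) d2 by auto
    qed
    define g where "g = (\<lambda>t. f (x + t *\<^sub>R h + s *\<^sub>R k) - f (x + t *\<^sub>R h))"
    define g' where "g' = (\<lambda>t. f' (x + t *\<^sub>R h + s *\<^sub>R k) h - f' (x + t *\<^sub>R h) h)"
    have dg: "(g has_real_derivative g' t) (at t)" if "0 \<le> t" "t \<le> s" for t
    proof -
      have 1: "(f has_derivative f' (x + t *\<^sub>R h + s *\<^sub>R k)) (at (x + t *\<^sub>R h + s *\<^sub>R k))"
        using df inU[OF that, of s] s by auto
      have 2: "(f has_derivative f' (x + t *\<^sub>R h)) (at (x + t *\<^sub>R h))"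
        using df inU[OF that, of 0] s by auto
      have a1: "((\<lambda>t. x + t *\<^sub>R h + s *\<^sub>R k) has_derivative (\<lambda>u. u *\<^sub>R h)) (at t)"
        by (auto intro!: derivative_eq_intros)
      have a2: "((\<lambda>t. x + t *\<^sub>R h) has_derivative (\<lambda>u. u *\<^sub>R h)) (at t)"
        by (auto intro!: derivative_eq_intros)
      from has_derivative_diff[OF has_derivative_compose[OF a1 1] has_derivative_compose[OF a2 2]]
      show ?thesis
        unfolding g_def g'_def has_field_derivative_def
        by (rule has_derivative_eq_rhs) (auto simp: blinfun.scaleR_right algebra_simps)
    qed
    obtain \<tau> where \<tau>: "0 < \<tau>" "\<tau> < s" "g s - g 0 = (s - 0) * g' \<tau>"
      using MVT2[of 0 s g g'] s dg by auto
    define y1 y2 where "y1 = x + \<tau> *\<^sub>R h + s *\<^sub>R k" and "y2 = x + \<tau> *\<^sub>R h"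
    have n1: "norm (y1 - x) \<le> s * m" using nb[of \<tau> s] \<tau> s by (simp add: y1_def add.assoc)
    have n2: "norm (y2 - x) \<le> s * m" using nb[of \<tau> 0] \<tau> s by (simp add: y2_def)
    have b: "\<bar>(f' y - f' x - f'' (y - x)) h\<bar> \<le> e' * (s * m) * m" if "norm (y - x) \<le> s * m" for y
    proof -
      have "\<bar>(f' y - f' x - f'' (y - x)) h\<bar> \<le> norm (f' y - f' x - f'' (y - x)) * norm h"
        using norm_blinfun by (metis real_norm_def)
      also have "\<dots> \<le> e' * (s * m) * m"
        using d1(2)[of y] that sm m e' s
        by (intro mult_mono) (auto intro!: order_trans[OF d1(2)] mult_left_mono)
      finally show ?thesis .
    qed
    have "g' \<tau> - s * f'' k h
        = (f' y1 - f' x - f'' (y1 - x)) h - (f' y2 - f' x - f'' (y2 - x)) h"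
      unfolding g'_def y1_def y2_def
      by (simp add: blinfun.bilinear_simps algebra_simps)
    then have "\<bar>g' \<tau> - s * f'' k h\<bar> \<le> 2 * (e' * (s * m) * m)"
      using b[OF n1] b[OF n2] by linarith
    also have "\<dots> = e * s" using m by (simp add: e'_def field_simps)
    finally have *: "\<bar>g' \<tau> - s * f'' k h\<bar> \<le> e * s" .
    have "f (x + s *\<^sub>R h + s *\<^sub>R k) - f (x + s *\<^sub>R h) - f (x + s *\<^sub>R k) + f x - s\<^sup>2 * f'' k h
        = s * (g' \<tau> - s * f'' k h)"
      using \<tau>(3) by (simp add: g_def algebra_simps power2_eq_square)
    then show "\<bar>f (x + s *\<^sub>R h + s *\<^sub>R k) - f (x + s *\<^sub>R h) - f (x + s *\<^sub>R k) + f x - s\<^sup>2 * f'' k h\<bar>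
        \<le> e * s\<^sup>2"
      using * s by (simp add: abs_mult power2_eq_square mult_left_mono)
  qed
qed

text \<open>The second difference is symmetric in \<open>h\<close> and \<open>k\<close>, so its limit is.\<close>

lemma second_derivative_symmetric:
  fixes f :: "'a::real_normed_vector \<Rightarrow> real"
    and f' :: "'a \<Rightarrow> 'a \<Rightarrow>\<^sub>L real" and f'' :: "'a \<Rightarrow>\<^sub>L ('a \<Rightarrow>\<^sub>L real)"
  assumes "open U" "x \<in> U"
    and "\<And>y. y \<in> U \<Longrightarrow> (f has_derivative f' y) (at y)"
    and "(f' has_derivative f'') (at x)"
  shows "f'' h k = f'' k h"
proof (rule ccontr)
  assume ne: "f'' h k \<noteq> f'' k h"
  define e where "e = \<bar>f'' h k - f'' k h\<bar> / 3"
  have e: "e > 0" using ne by (simp add: e_def)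
  obtain d1 where d1: "d1 > 0" "\<And>s. 0 < s \<Longrightarrow> s < d1 \<Longrightarrow>
     \<bar>f (x + s *\<^sub>R h + s *\<^sub>R k) - f (x + s *\<^sub>R h) - f (x + s *\<^sub>R k) + f x - s\<^sup>2 * f'' k h\<bar> \<le> e * s\<^sup>2"
    using second_difference[OF assms e] by blast
  obtain d2 where d2: "d2 > 0" "\<And>s. 0 < s \<Longrightarrow> s < d2 \<Longrightarrow>
     \<bar>f (x + s *\<^sub>R k + s *\<^sub>R h) - f (x + s *\<^sub>R k) - f (x + s *\<^sub>R h) + f x - s\<^sup>2 * f'' h k\<bar> \<le> e * s\<^sup>2"
    using second_difference[OF assms e] by blast
  define s where "s = min d1 d2 / 2"
  have s: "0 < s" "s < d1" "s < d2" using d1(1) d2(1) by (auto simp: s_def)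
  have sw: "x + s *\<^sub>R k + s *\<^sub>R h = x + s *\<^sub>R h + s *\<^sub>R k" by simp
  have "\<bar>s\<^sup>2 * f'' h k - s\<^sup>2 * f'' k h\<bar> \<le> 2 * (e * s\<^sup>2)"
    using d1(2)[OF s(1,2)] d2(2)[OF s(1,3)] unfolding sw by linarith
  moreover have "\<bar>s\<^sup>2 * f'' h k - s\<^sup>2 * f'' k h\<bar> = s\<^sup>2 * \<bar>f'' h k - f'' k h\<bar>"
    by (simp add: abs_mult right_diff_distrib[symmetric])
  ultimately have "s\<^sup>2 * \<bar>f'' h k - f'' k h\<bar> \<le> s\<^sup>2 * (2 * e)" by (simp only: ac_simps)
  then have "\<bar>f'' h k - f'' k h\<bar> \<le> 2 * e" using s(1) by (simp add: mult_le_cancel_left)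
  then show False using e unfolding e_def by simp
qed

text \<open>The inverse function theorem, supplemented by the continuity of the derivative of the inverse: near a
given point the operators \<open>F' (G z)\<close> are bounded below by a common constant, so that
\<open>F' (G z) (G' z w - G' y w) = (F' (G y) - F' (G z)) (G' y w)\<close> forces \<open>G' z w\<close> to be close to \<open>G' y w\<close>.\<close>

lemma C1_local_inverse:
  fixes F :: "'a::euclidean_space \<Rightarrow> 'a" and F' :: "'a \<Rightarrow> 'a \<Rightarrow>\<^sub>L 'a"
  assumes "open U" "u \<in> U"
    and dF: "\<And>x. x \<in> U \<Longrightarrow> (F has_derivative F' x) (at x)"
    and cF: "continuous_on U F'"
    and inj: "inj (blinfun_apply (F' u))"
  obtains U' W G and G' :: "'a \<Rightarrow> 'a \<Rightarrow>\<^sub>L 'a" where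
    "open U'" "U' \<subseteq> U" "u \<in> U'" "open W" "F u \<in> W" "homeomorphism U' W F G"
    "\<And>y. y \<in> W \<Longrightarrow> (G has_derivative G' y) (at y)" "continuous_on W G'"
    "\<And>y w. y \<in> W \<Longrightarrow> F' (G y) (G' y w) = w" "\<And>y w. y \<in> W \<Longrightarrow> G' y (F' (G y) w) = w"
proof -
  obtain h where h: "linear h" "h \<circ> blinfun_apply (F' u) = id"
    using linear_injective_left_inverse[OF _ inj] blinfun.bounded_linear_right bounded_linear.linear
    by blast
  have "Blinfun h o\<^sub>L F' u = id_blinfun"
    using h by (intro blinfun_eqI) (simp add: bounded_linear_Blinfun_apply linear_linear fun_eq_iff)
  from inverse_function_theorem[OF \<open>open U\<close> dF cF \<open>u \<in> U\<close> this]
  obtain U' W G g' where o: "open U'" "U' \<subseteq> U" "u \<in> U'" "open W" "F u \<in> W" "homeomorphism U' W F G"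
    and dG: "\<And>y. y \<in> W \<Longrightarrow> (G has_derivative (g' y)) (at y)"
    and g': "\<And>y. y \<in> W \<Longrightarrow> g' y = inv (blinfun_apply (F' (G y)))"
    and bij: "\<And>y. y \<in> W \<Longrightarrow> bij (blinfun_apply (F' (G y)))"
    by metis
  define G' where "G' y = Blinfun (g' y)" for y
  have G'_app: "blinfun_apply (G' y) = g' y" if "y \<in> W" for y
    unfolding G'_def using dG[OF that] by (simp add: bounded_linear_Blinfun_apply has_derivative_bounded_linear)
  have r: "F' (G y) (G' y w) = w" if "y \<in> W" for y w
    using bij[OF that] by (simp add: G'_app that g' bij_is_surj surj_f_inv_f)
  have l: "G' y (F' (G y) w) = w" if "y \<in> W" for y w
    using bij[OF that] by (simp add: G'_app that g' bij_is_inj inv_f_f)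
  have "continuous_on W G" using o(6) by (simp add: homeomorphism_def)
  moreover have GW: "G ` W \<subseteq> U" using o(2,6) by (auto simp: homeomorphism_def)
  ultimately have cFG: "continuous_on W (\<lambda>y. F' (G y))"
    by (intro continuous_on_compose2[OF cF])
  have "continuous_on W G'"
  proof (rule continuous_on_blinfun_componentwise)
    fix w :: 'a
    show "continuous_on W (\<lambda>y. G' y w)"
      unfolding continuous_on_eq_continuous_at[OF o(4)]
    proof
      fix y assume y: "y \<in> W"
      define c where "c = 1 / (2 * (norm (G' y) + 1))"
      have c: "c > 0" by (simp add: c_def add_nonneg_pos)
      have lb: "2 * c * norm v \<le> norm (F' (G y) v)" for v
      proof -
        have "norm v \<le> norm (G' y) * norm (F' (G y) v)" using norm_blinfun[of "G' y"] l[OF y] by metis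
        also have "\<dots> \<le> (norm (G' y) + 1) * norm (F' (G y) v)" by (simp add: mult_right_mono)
        finally have "norm v / (norm (G' y) + 1) \<le> norm (F' (G y) v)"
          by (simp add: pos_divide_le_eq add_nonneg_pos mult.commute)
        moreover have "2 * c = 1 / (norm (G' y) + 1)" unfolding c_def by (simp add: divide_simps)
        ultimately show ?thesis by simp
      qed
      have cont: "((\<lambda>z. F' (G z)) \<longlongrightarrow> F' (G y)) (at y)"
        using cFG y o(4) by (metis continuous_on_eq_continuous_at isCont_def)
      have "((\<lambda>z. G' z w) \<longlongrightarrow> G' y w) (at y)"
      proof (rule LIM_zero_cancel)
        show "((\<lambda>z. G' z w - G' y w) \<longlongrightarrow> 0) (at y)"
        proof (rule Lim_null_comparison)
          have e1: "eventually (\<lambda>z. dist (F' (G z)) (F' (G y)) < c) (at y)"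
            using cont c by (rule tendstoD)
          have e2: "eventually (\<lambda>z. z \<in> W) (at y)" using o(4) y by (simp add: eventually_at_topological) blast
          show "eventually (\<lambda>z. norm (G' z w - G' y w)
              \<le> norm (F' (G y) - F' (G z)) * norm (G' y w) / c) (at y)"
            using e1 e2
          proof eventually_elim
            case (elim z)
            define v where "v = G' z w - G' y w"
            have "F' (G z) v = (F' (G y) - F' (G z)) (G' y w)"
              using r[OF elim(2)] r[OF y] by (simp add: v_def blinfun.bilinear_simps)
            then have 1: "norm (F' (G z) v) \<le> norm (F' (G y) - F' (G z)) * norm (G' y w)"
              using norm_blinfun by metis
            have "norm ((F' (G z) - F' (G y)) v) \<le> norm (F' (G z) - F' (G y)) * norm v"
              by (rule norm_blinfun)
            also have "\<dots> \<le> c * norm v" using elim(1) by (intro mult_right_mono) (auto simp: dist_norm)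
            finally have "norm (F' (G z) v - F' (G y) v) \<le> c * norm v" by (simp add: blinfun.diff_left)
            then have "c * norm v \<le> norm (F' (G z) v)"
              using lb[of v] norm_triangle_ineq2[of "F' (G y) v" "F' (G z) v"]
              by (simp add: norm_minus_commute)
            with 1 have "c * norm v \<le> norm (F' (G y) - F' (G z)) * norm (G' y w)" by linarith
            then show ?case using c by (simp add: v_def field_simps)
          qed
          have "((\<lambda>z. norm (F' (G y) - F' (G z)) * norm (G' y w) / c) \<longlongrightarrow>
              norm (F' (G y) - F' (G y)) * norm (G' y w) / c) (at y)"
            using c by (intro tendsto_intros cont) auto
          then show "((\<lambda>z. norm (F' (G y) - F' (G z)) * norm (G' y w) / c) \<longlongrightarrow> 0) (at y)" by simp
        qed
      qed
      then show "isCont (\<lambda>y. G' y w) y" by (simp add: isCont_def)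
    qed
  qed
  with o dG G'_app r l show thesis by (intro that[of U' W G G']) auto
qed

lemma has_derivative_normalize:
  fixes f :: "'a::real_normed_vector \<Rightarrow> 'b::real_inner"
  assumes "(f has_derivative f') (at x within s)" "f x \<noteq> 0"
  shows "((\<lambda>x. f x /\<^sub>R norm (f x)) has_derivative
      (\<lambda>w. f' w /\<^sub>R norm (f x) - (f x \<bullet> f' w / norm (f x) ^ 3) *\<^sub>R f x)) (at x within s)"
proof -
  have n: "(norm has_derivative (\<lambda>h. h \<bullet> sgn (f x))) (at (f x))"
    using has_derivative_norm[OF assms(2)] by (simp add: inner_commute)
  have "((\<lambda>x. norm (f x)) has_derivative (\<lambda>w. f' w \<bullet> sgn (f x))) (at x within s)"
    using has_derivative_compose[OF assms(1) n] .
  from has_derivative_scaleR[OF Deriv.has_derivative_inverse[OF _ this] assms(1)]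
  have "((\<lambda>x. f x /\<^sub>R norm (f x)) has_derivative
     (\<lambda>h. inverse (norm (f x)) *\<^sub>R f' h +
          - (inverse (norm (f x)) * (f' h \<bullet> sgn (f x)) * inverse (norm (f x))) *\<^sub>R f x)) (at x within s)"
    using assms(2) by simp
  then show ?thesis
    by (rule has_derivative_eq_rhs)
      (auto simp: fun_eq_iff sgn_div_norm inner_commute power3_eq_cube field_simps)
qed

text \<open>The Picard operator \<open>x \<mapsto> (\<lambda>t. x0 + \<integral>\<^sub>0\<^sup>t P (Q s) (x s) ds)\<close> is a contraction once the time
interval is short. It acts on bounded continuous functions on the whole line; times outside
\<open>{0..\<epsilon>}\<close> are moved to the nearest endpoint.\<close>

lemma linear_ODE_short_time:
  fixes Q :: "real \<Rightarrow> 'q::real_normed_vector" and x0 :: "'a::euclidean_space"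
    and P :: "'q \<Rightarrow> 'a \<Rightarrow> 'a"
  assumes bil: "bounded_bilinear P" and "0 < l" and contQ: "continuous_on {0..l} Q"
  obtains \<epsilon> x where "0 < \<epsilon>" "\<epsilon> \<le> l" "x 0 = x0" "continuous_on {0..\<epsilon>} x"
    "\<And>t. t \<in> {0..\<epsilon>} \<Longrightarrow> (x has_vector_derivative P (Q t) (x t)) (at t within {0..\<epsilon>})"
proof -
  interpret bounded_bilinear P by (rule bil)
  obtain K where K: "0 < K" "\<And>a b. norm (P a b) \<le> norm a * norm b * K"
    using pos_bounded by blast
  have "compact (Q ` {0..l})" using contQ by (intro compact_continuous_image) auto
  then obtain B where B: "0 < B" "\<And>t. t \<in> {0..l} \<Longrightarrow> norm (Q t) \<le> B"
    using compact_imp_bounded bounded_pos by (metis imageI)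
  \<comment> \<open>makes the Lipschitz constant \<open>\<epsilon> B K\<close> of the Picard operator at most \<open>1/2\<close>\<close>
  define \<epsilon> where "\<epsilon> = min l (1 / (2 * B * K))"
  have \<epsilon>: "0 < \<epsilon>" "\<epsilon> \<le> l" "\<epsilon> * (B * K) \<le> 1 / 2"
  proof -
    show "0 < \<epsilon>" "\<epsilon> \<le> l" using \<open>0 < l\<close> B K by (auto simp: \<epsilon>_def)
    have "\<epsilon> \<le> 1 / (2 * B * K)" by (simp add: \<epsilon>_def)
    then have "\<epsilon> * (B * K) \<le> 1 / (2 * B * K) * (B * K)" using B K by (intro mult_right_mono) auto
    then show "\<epsilon> * (B * K) \<le> 1 / 2" using B K by simp
  qed
  define cl where "cl t = max 0 (min \<epsilon> t)" for t :: real
  have cl: "0 \<le> cl t" "cl t \<le> \<epsilon>" for t using \<epsilon> by (auto simp: cl_def)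
  have cl_id: "cl t = t" if "t \<in> {0..\<epsilon>}" for t using that by (auto simp: cl_def)
  define J where "J x t = x0 + integral {0..cl t} (\<lambda>s. P (Q s) (x s))" for x t
  have contP: "continuous_on {0..\<epsilon>} (\<lambda>s. P (Q s) (x s))" if "continuous_on {0..\<epsilon>} x" for x
    using that continuous_on_subset[OF contQ, of "{0..\<epsilon>}"] \<epsilon>(2) by (intro continuous_on) auto
  have int: "(\<lambda>s. P (Q s) (x s)) integrable_on {0..cl t}" if "continuous_on {0..\<epsilon>} x" for x t
    using continuous_on_subset[OF contP[OF that], of "{0..cl t}"] cl[of t]
    by (intro integrable_continuous_interval) auto
  have J_bc: "J x \<in> bcontfun" if "continuous_on {0..\<epsilon>} x" for x
  proof -
    have "continuous_on {0..\<epsilon>} (\<lambda>t. integral {0..t} (\<lambda>s. P (Q s) (x s)))"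
      by (intro indefinite_integral_continuous_1 integrable_continuous_interval contP that)
    then have "continuous_on UNIV (\<lambda>t. integral {0..cl t} (\<lambda>s. P (Q s) (x s)))"
      by (rule continuous_on_compose2) (use \<epsilon> in \<open>auto simp: cl_def intro!: continuous_intros\<close>)
    then have c: "continuous_on UNIV (J x)" unfolding J_def by (intro continuous_intros)
    have "range (J x) = J x ` {0..\<epsilon>}"
    proof -
      have "J x t = J x (cl t)" for t using cl_id[of "cl t"] cl[of t] by (simp add: J_def)
      then show ?thesis using cl by (force simp: image_def)
    qed
    moreover have "compact (J x ` {0..\<epsilon>})"
      using c by (intro compact_continuous_image) (auto intro: continuous_on_subset)
    ultimately show ?thesis using c by (simp add: bcontfun_def compact_imp_bounded)
  qed
  define F where "F x = Bcontfun (J (apply_bcontfun x))" for x :: "real \<Rightarrow>\<^sub>C 'a"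
  have F: "apply_bcontfun (F x) t = J (apply_bcontfun x) t" for x t
    unfolding F_def by (subst Bcontfun_inverse) (auto intro: J_bc)
  have "\<exists>!x. F x = x"
  proof (rule banach_fix_type[of "1/2"])
    show "\<forall>x y. dist (F x) (F y) \<le> 1 / 2 * dist x y"
    proof (intro allI dist_bound)
      fix x y :: "real \<Rightarrow>\<^sub>C 'a" and t :: real
      have d: "norm (P (Q s) (x s) - P (Q s) (y s)) \<le> B * K * dist x y" if "s \<in> {0..cl t}" for s
      proof -
        have "norm (P (Q s) (x s) - P (Q s) (y s)) = norm (P (Q s) (x s - y s))"
          by (simp add: diff_right)
        also have "\<dots> \<le> norm (Q s) * norm (x s - y s) * K" by (rule K)
        also have "\<dots> \<le> B * dist x y * K"
          using B(2)[of s] that cl[of t] \<epsilon> K(1) B(1) dist_bounded[of x s y]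
          by (intro mult_right_mono mult_mono) (auto simp: dist_norm[of "_::'a"])
        finally show ?thesis by (simp add: ac_simps)
      qed
      have "dist (F x t) (F y t) = norm (integral {0..cl t} (\<lambda>s. P (Q s) (x s) - P (Q s) (y s)))"
        by (simp add: F J_def dist_norm int integral_diff)
      also have "\<dots> \<le> B * K * dist x y * (cl t - 0)"
      proof (rule integral_bound)
        show "continuous_on {0..cl t} (\<lambda>s. P (Q s) (x s) - P (Q s) (y s))"
          using cl[of t] by (intro continuous_intros continuous_on_subset[OF contP, of _ "{0..cl t}"]) auto
      qed (use d cl in auto)
      also have "\<dots> \<le> (\<epsilon> * (B * K)) * dist x y"
        using cl[of t] B(1) K(1) by (simp add: mult_right_mono ac_simps mult_left_mono)
      also have "\<dots> \<le> 1 / 2 * dist x y" using \<epsilon>(3) by (intro mult_right_mono) auto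
      finally show "dist (F x t) (F y t) \<le> 1 / 2 * dist x y" .
    qed
  qed auto
  then obtain x where x: "F x = x" by blast
  have xJ: "apply_bcontfun x t = x0 + integral {0..t} (\<lambda>s. P (Q s) (x s))" if "t \<in> {0..\<epsilon>}" for t
    using F[of x t] x cl_id[OF that] by (simp add: J_def)
  show thesis
  proof (rule that[of \<epsilon> "apply_bcontfun x"])
    show "apply_bcontfun x 0 = x0" using xJ[of 0] \<epsilon> by simp
    fix t assume t: "t \<in> {0..\<epsilon>}"
    have "((\<lambda>t. integral {0..t} (\<lambda>s. P (Q s) (x s))) has_vector_derivative P (Q t) (x t))
        (at t within {0..\<epsilon>})"
      using t contP by (intro integral_has_vector_derivative) auto
    from has_vector_derivative_add[OF has_vector_derivative_const this]
    have "((\<lambda>t. x0 + integral {0..t} (\<lambda>s. P (Q s) (x s))) has_vector_derivative P (Q t) (x t))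
        (at t within {0..\<epsilon>})" by simp
    then show "(apply_bcontfun x has_vector_derivative P (Q t) (x t)) (at t within {0..\<epsilon>})"
      by (rule has_vector_derivative_transform[OF t xJ, rotated]) simp
  qed (use \<epsilon> in auto)
qed

section \<open>Curves on a closed interval\<close>

lemma time_deriv_eq:
  fixes g :: "real \<Rightarrow> 'a::euclidean_space"
  assumes "(g has_vector_derivative d) (at t within {0..l})" "t \<in> {0..l}" "0 < l"
  shows "time_deriv l g t = d"
  unfolding time_deriv_def using assms
  by (intro vector_derivative_within_closed_interval[of 0 l]) auto

lemma C1_uptoI:
  fixes g :: "real \<Rightarrow> 'a::euclidean_space"
  assumes "0 < l" "\<And>t. t \<in> {0..l} \<Longrightarrow> (g has_vector_derivative g' t) (at t within {0..l})"
    "continuous_on {0..l} g'"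
  shows "C1_upto l g"
proof -
  have "continuous_on {0..l} (time_deriv l g) \<longleftrightarrow> continuous_on {0..l} g'"
    using assms by (intro continuous_on_cong) (auto simp: time_deriv_eq)
  then show ?thesis
    unfolding C1_upto_def differentiable_on_def using assms
    by (meson differentiableI_vector)
qed

lemma C1_uptoD:
  assumes "C1_upto l g" "t \<in> {0..l}"
  shows "(g has_vector_derivative time_deriv l g t) (at t within {0..l})"
  using assms unfolding C1_upto_def time_deriv_def differentiable_on_def
  by (auto simp: vector_derivative_works)

lemma C1_upto_continuous: "C1_upto l g \<Longrightarrow> continuous_on {0..l} g"
  by (simp add: C1_upto_def differentiable_imp_continuous_on)

lemma C2_uptoI:
  fixes g :: "real \<Rightarrow> 'a::euclidean_space"
  assumes l: "0 < l" and d: "\<And>t. t \<in> {0..l} \<Longrightarrow> (g has_vector_derivative g' t) (at t within {0..l})"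
    and dd: "\<And>t. t \<in> {0..l} \<Longrightarrow> (g' has_vector_derivative g'' t) (at t within {0..l})"
    and c: "continuous_on {0..l} g''"
  shows "C2_upto l g"
proof -
  have "continuous_on {0..l} g'"
    using dd by (meson continuous_on_vector_derivative)
  then have 1: "C1_upto l g" using C1_uptoI[OF l d] by blast
  have "C1_upto l (time_deriv l g)"
  proof (rule C1_uptoI[OF l _ c])
    fix t assume t: "t \<in> {0..l}"
    show "(time_deriv l g has_vector_derivative g'' t) (at t within {0..l})"
      by (rule has_vector_derivative_transform[OF t _ dd[OF t]]) (simp add: time_deriv_eq d l)
  qed
  with 1 show ?thesis by (simp add: C2_upto_def)
qed

text \<open>If \<open>T\<close> is the unit tangent of \<open>\<delta>\<close> and \<open>G\<close> the local inverse of its arc length, then \<open>\<delta> \<circ> G\<close> has velocity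
\<open>T \<circ> G\<close>, so its second derivative involves only the first derivatives of \<open>T\<close> and \<open>G\<close>.\<close>

lemma arclength_reparametrization:
  fixes \<delta> :: "real \<Rightarrow> 'a::euclidean_space"
  assumes e: "0 < e"
    and d: "\<And>t. \<bar>t\<bar> < e \<Longrightarrow> (\<delta> has_vector_derivative \<delta>' t) (at t)"
    and dd: "\<And>t. \<bar>t\<bar> < e \<Longrightarrow> (\<delta>' has_vector_derivative \<delta>'' t) (at t)"
    and c: "continuous_on {-e<..<e} \<delta>''"
    and ne: "\<delta>' 0 \<noteq> 0"
  obtains l \<gamma> where "0 < l" "C2_upto l \<gamma>" "\<gamma> ` {0..l} \<subseteq> \<delta> ` {-e<..<e}" "\<gamma> 0 = \<delta> 0"
    "time_deriv l \<gamma> 0 = \<delta>' 0 /\<^sub>R norm (\<delta>' 0)" "\<And>t. t \<in> {0..l} \<Longrightarrow> norm (time_deriv l \<gamma> t) = 1"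
proof -
  have c': "continuous_on {-e<..<e} \<delta>'"
  proof (intro continuous_at_imp_continuous_on ballI)
    fix t assume "t \<in> {-e<..<e}"
    then have "\<bar>t\<bar> < e" by auto
    from has_vector_derivative_continuous[OF dd[OF this]] show "isCont \<delta>' t" .
  qed
  have "isCont \<delta>' 0" using has_vector_derivative_continuous[OF dd[of 0]] e by simp
  then have "eventually (\<lambda>t. \<delta>' t \<noteq> 0) (at 0)"
    using ne by (simp add: isCont_def tendsto_imp_eventually_ne)
  then obtain a where a: "a > 0" "\<And>t. t \<noteq> 0 \<Longrightarrow> \<bar>t\<bar> < a \<Longrightarrow> \<delta>' t \<noteq> 0"
    by (auto simp: eventually_at dist_real_def)
  define b where "b = min a e / 2"
  have b: "0 < b" "b < e" "b < a" using a e by (auto simp: b_def)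
  have nz: "\<delta>' t \<noteq> 0" if "\<bar>t\<bar> \<le> b" for t using a(2)[of t] ne b that by (cases "t = 0") auto
  define s where "s t = integral {-b..t} (\<lambda>x. norm (\<delta>' x)) - integral {-b..0} (\<lambda>x. norm (\<delta>' x))" for t
  have cn: "continuous_on {-b..b} (\<lambda>x. norm (\<delta>' x))"
    using b by (intro continuous_intros continuous_on_subset[OF c']) auto
  have ds: "(s has_real_derivative norm (\<delta>' t)) (at t)" if "t \<in> {-b<..<b}" for t
  proof -
    have "((\<lambda>t. integral {-b..t} (\<lambda>x. norm (\<delta>' x))) has_real_derivative norm (\<delta>' t)) (at t within {-b..b})"
      using that by (intro integral_has_real_derivative cn) auto
    moreover have "at t within {-b..b} = at t"
      using that by (intro at_within_interior) (auto simp: interior_atLeastAtMost_real)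
    ultimately have "((\<lambda>t. integral {-b..t} (\<lambda>x. norm (\<delta>' x))) has_real_derivative norm (\<delta>' t)) (at t)"
      by simp
    then show ?thesis unfolding s_def by (auto intro!: derivative_eq_intros)
  qed
  define s' where "s' t = blinfun_scaleR_right (norm (\<delta>' t)) o\<^sub>L (id_blinfun :: real \<Rightarrow>\<^sub>L real)" for t
  have s'_app: "blinfun_apply (s' t) w = norm (\<delta>' t) * w" for t w by (simp add: s'_def)
  have s'c: "continuous_on {-b<..<b} s'"
    unfolding s'_def
    by (intro continuous_intros continuous_on_subset[OF cn]) auto
  have s'd: "(s has_derivative s' t) (at t)" if "t \<in> {-b<..<b}" for t
    using ds[OF that] unfolding has_field_derivative_def
    by (rule has_derivative_eq_rhs) (auto simp: s'_app)
  have s'i: "inj (blinfun_apply (s' 0))" using ne by (auto simp: inj_on_def s'_app)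
  have "(0::real) \<in> {-b<..<b}" using b by simp
  from C1_local_inverse[OF open_greaterThanLessThan this s'd s'c s'i]
  obtain U' W G G' where G: "U' \<subseteq> {-b<..<b}" "0 \<in> U'"
      "open W" "s 0 \<in> W" "homeomorphism U' W s G"
      "\<And>y. y \<in> W \<Longrightarrow> (G has_derivative blinfun_apply (G' y)) (at y)"
      "\<And>y w. y \<in> W \<Longrightarrow> blinfun_apply (s' (G y)) (blinfun_apply (G' y) w) = w"
    by metis
  have s0: "s 0 = 0" by (simp add: s_def)
  have G0: "G 0 = 0" using G(2,5) s0 by (metis homeomorphism_apply1)
  have GW: "G y \<in> {-b<..<b}" if "y \<in> W" for y using that G(1,5) unfolding homeomorphism_def by blast
  have nzG: "\<delta>' (G y) \<noteq> 0" if "y \<in> W" for y using GW[OF that] by (intro nz) auto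
  have dG: "(G has_real_derivative inverse (norm (\<delta>' (G y)))) (at y)" if "y \<in> W" for y
  proof -
    have "blinfun_apply (G' y) w = inverse (norm (\<delta>' (G y))) * w" for w
      using G(7)[OF that, of w] nzG[OF that] by (simp add: s'_app field_simps)
    then have "blinfun_apply (G' y) = (*) (inverse (norm (\<delta>' (G y))))" by (simp add: fun_eq_iff)
    then show ?thesis using G(6)[OF that] unfolding has_field_derivative_def by simp
  qed
  define T where "T t = \<delta>' t /\<^sub>R norm (\<delta>' t)" for t
  define T' where "T' t = \<delta>'' t /\<^sub>R norm (\<delta>' t) - (\<delta>' t \<bullet> \<delta>'' t / norm (\<delta>' t) ^ 3) *\<^sub>R \<delta>' t" for t
  have dT: "(T has_vector_derivative T' t) (at t)" if "t \<in> {-b<..<b}" for t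
  proof -
    have "(\<delta>' has_derivative (\<lambda>w. w *\<^sub>R \<delta>'' t)) (at t)"
      using dd[of t] that b by (auto simp: has_vector_derivative_def)
    from has_derivative_normalize[OF this nz]
    have "(T has_derivative (\<lambda>w. (w *\<^sub>R \<delta>'' t) /\<^sub>R norm (\<delta>' t)
        - (\<delta>' t \<bullet> (w *\<^sub>R \<delta>'' t) / norm (\<delta>' t) ^ 3) *\<^sub>R \<delta>' t)) (at t)"
      using that unfolding T_def by auto
    moreover have "(w *\<^sub>R \<delta>'' t) /\<^sub>R norm (\<delta>' t)
        - (\<delta>' t \<bullet> (w *\<^sub>R \<delta>'' t) / norm (\<delta>' t) ^ 3) *\<^sub>R \<delta>' t = w *\<^sub>R T' t" for w
      by (simp add: T'_def scaleR_diff_right scaleR_left_commute)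
    ultimately show ?thesis unfolding has_vector_derivative_def by simp
  qed
  have d1: "((\<delta> \<circ> G) has_vector_derivative T (G y)) (at y)" if "y \<in> W" for y
  proof -
    have "(\<delta> has_vector_derivative \<delta>' (G y)) (at (G y))" using GW[OF that] b by (intro d) auto
    from vector_diff_chain_at[OF dG[OF that, unfolded has_real_derivative_iff_has_vector_derivative] this]
    show ?thesis by (simp add: T_def)
  qed
  have d2: "((T \<circ> G) has_vector_derivative T' (G y) /\<^sub>R norm (\<delta>' (G y))) (at y)" if "y \<in> W" for y
    using vector_diff_chain_at[OF dG[OF that, unfolded has_real_derivative_iff_has_vector_derivative] dT[OF GW[OF that]]]
    by simp
  obtain l0 where l0: "l0 > 0" "ball 0 l0 \<subseteq> W" using G(3,4) s0 openE by metis
  define l where "l = l0 / 2"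
  have l: "0 < l" "{0..l} \<subseteq> W" using l0 by (auto simp: l_def subset_iff)
  have cG: "continuous_on {0..l} G"
    using G(5) l(2) by (meson continuous_on_subset homeomorphism_cont2)
  have Gl: "G ` {0..l} \<subseteq> {-b<..<b}" using GW l by auto
  have Gle: "G ` {0..l} \<subseteq> {-e<..<e}" using Gl b by auto
  have 1: "((\<delta> \<circ> G) has_vector_derivative (T \<circ> G) y) (at y within {0..l})" if "y \<in> {0..l}" for y
    using has_vector_derivative_at_within[OF d1[OF subsetD[OF l(2) that]]] by simp
  have 2: "((T \<circ> G) has_vector_derivative T' (G y) /\<^sub>R norm (\<delta>' (G y))) (at y within {0..l})"
    if "y \<in> {0..l}" for y
    using has_vector_derivative_at_within[OF d2[OF subsetD[OF l(2) that]]] .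
  have 3: "continuous_on {0..l} (\<lambda>y. T' (G y) /\<^sub>R norm (\<delta>' (G y)))"
  proof -
    have "continuous_on {0..l} (\<lambda>y. \<delta>' (G y))" "continuous_on {0..l} (\<lambda>y. \<delta>'' (G y))"
      using continuous_on_compose2[OF c' cG Gle] continuous_on_compose2[OF c cG Gle] by auto
    moreover have "\<forall>y\<in>{0..l}. \<delta>' (G y) \<noteq> 0" using nzG l by auto
    ultimately show ?thesis unfolding T'_def
      by (intro continuous_intros) simp_all
  qed
  have td: "time_deriv l (\<delta> \<circ> G) y = T (G y)" if "y \<in> {0..l}" for y
    using time_deriv_eq[OF 1 that l(1)] that by simp
  have 4: "C2_upto l (\<delta> \<circ> G)" by (rule C2_uptoI[OF l(1) 1 2 3])
  have 5: "(\<delta> \<circ> G) ` {0..l} \<subseteq> \<delta> ` {-e<..<e}" using Gle by (metis image_comp image_mono)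
  have 6: "time_deriv l (\<delta> \<circ> G) 0 = \<delta>' 0 /\<^sub>R norm (\<delta>' 0)"
    using td[of 0] l(1) by (simp add: T_def G0)
  have 7: "norm (time_deriv l (\<delta> \<circ> G) t) = 1" if "t \<in> {0..l}" for t
    using td[OF that] nzG[OF subsetD[OF l(2) that]] by (simp add: T_def)
  have 8: "(\<delta> \<circ> G) 0 = \<delta> 0" by (simp add: G0)
  show thesis by (rule that[OF l(1) 4 5 8 6 7])
qed

section \<open>Frames of a plane and quadratic forms\<close>

lemma bounded_bilinear_cross: "bounded_bilinear cross3"
  using bilinear_cross bilinear_conv_bounded_bilinear by blast

lemma bounded_linear_matrix_vector_left: "bounded_linear (\<lambda>M::real^3^3. M *v x)"
  by (rule linear_conv_bounded_linear[THEN iffD1], rule linearI)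
    (simp_all add: matrix_vector_mult_add_rdistrib scaleR_matrix_vector_assoc)

lemma matrix_cross: "matrix (cross3 w) *v x = cross3 w x"
proof -
  have "linear (cross3 w)"
    using bounded_bilinear.bounded_linear_right[OF bounded_bilinear_cross] bounded_linear.linear by blast
  then show ?thesis by (simp add: matrix_works)
qed

lemma cross_frame:
  fixes n x :: "real^3"
  assumes "norm n = 1" "norm x = 1" "n \<bullet> x = 0"
  shows "norm (cross3 n x) = 1" "x \<bullet> (cross3 n x) = 0" "n \<bullet> (cross3 n x) = 0"
proof -
  have "(norm (cross3 n x))\<^sup>2 = 1" using norm_cross_dot[of n x] assms by simp
  then show "norm (cross3 n x) = 1" by (simp add: power2_eq_1_iff) (metis norm_ge_zero neg_0_le_iff_le not_one_le_zero)
qed (simp_all add: dot_cross_self)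

lemma tangent_plane_frame:
  fixes n :: "real^3"
  assumes "norm n = 1"
  obtains x y where "norm x = 1" "norm y = 1" "x \<bullet> y = 0" "n \<bullet> x = 0" "n \<bullet> y = 0"
proof -
  obtain z where z: "z \<noteq> 0" "orthogonal n z" using orthogonal_to_vector_exists[of n] by auto
  define x where "x = z /\<^sub>R norm z"
  have x: "norm x = 1" "n \<bullet> x = 0" using z by (simp_all add: x_def orthogonal_def)
  show thesis using that[of x "cross3 n x"] x cross_frame[OF assms x] by blast
qed

text \<open>Together with the unit normal \<open>n\<close>, the frame \<open>x, y\<close> is an orthonormal basis of space.\<close>

lemma frame_expansion:
  fixes n x y v :: "real^3"
  assumes "norm n = 1" "norm x = 1" "norm y = 1" "x \<bullet> y = 0" "n \<bullet> x = 0" "n \<bullet> y = 0" "n \<bullet> v = 0"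
  shows "v = (v \<bullet> x) *\<^sub>R x + (v \<bullet> y) *\<^sub>R y"
proof -
  have o: "n \<bullet> n = 1" "x \<bullet> x = 1" "y \<bullet> y = 1" using assms by (simp_all add: dot_square_norm)
  have ne: "n \<noteq> 0" "x \<noteq> 0" "y \<noteq> 0" using assms by auto
  have distinct: "n \<noteq> x" "n \<noteq> y" "x \<noteq> y" using assms o by auto
  have "independent {n, x, y}"
    using assms ne by (intro pairwise_orthogonal_independent) (auto simp: pairwise_def orthogonal_def inner_commute)
  moreover have "card {n, x, y} = 3" using distinct by simp
  ultimately have "span {n, x, y} = UNIV"
    using card_ge_dim_independent[of "{n, x, y}" UNIV] by auto
  define w where "w = v - ((v \<bullet> x) *\<^sub>R x + (v \<bullet> y) *\<^sub>R y)"
  have "orthogonal w z" if "z \<in> {n, x, y}" for z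
    using that assms o by (auto simp: w_def orthogonal_def inner_diff_right inner_add_right inner_commute)
  then have "orthogonal w w"
    using \<open>span _ = UNIV\<close> by (intro orthogonal_to_span[of w "{n,x,y}"]) auto
  then show ?thesis by (simp add: w_def orthogonal_def)
qed

text \<open>With \<open>(s, t) = (cos \<theta>, sin \<theta>)\<close> the form is \<open>(a + c) / 2 + (a - c) / 2 * cos 2\<theta> + b * sin 2\<theta>\<close>, and the
last two terms describe an oscillation of amplitude \<open>sqrt (((a - c) / 2)\<^sup>2 + b\<^sup>2)\<close>. Applied to the second
fundamental form this yields the principal curvatures, and so the mean curvature as half a trace and
umbilics as the points where the amplitude vanishes.\<close>

lemma quadratic_form_on_circle:
  fixes a b c :: real
  defines "Q \<equiv> {a * s\<^sup>2 + 2 * b * s * t + c * t\<^sup>2 | s t. s\<^sup>2 + t\<^sup>2 = 1}"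
    and "R \<equiv> sqrt (((a - c) / 2)\<^sup>2 + b\<^sup>2)"
  shows "Sup Q = (a + c) / 2 + R" "Inf Q = (a + c) / 2 - R"
proof -
  define m where "m = (a + c) / 2"
  define d where "d = (a - c) / 2"
  have R: "R\<^sup>2 = d\<^sup>2 + b\<^sup>2" "R \<ge> 0" by (simp_all add: R_def d_def)
  have form: "a * s\<^sup>2 + 2 * b * s * t + c * t\<^sup>2 = m + (d * (s\<^sup>2 - t\<^sup>2) + b * (2 * s * t))"
    if "s\<^sup>2 + t\<^sup>2 = 1" for s t :: real
  proof -
    have "m = m * (s\<^sup>2 + t\<^sup>2)" using that by simp
    then show ?thesis by (simp add: m_def d_def field_simps)
  qed
  have bd: "\<bar>d * (s\<^sup>2 - t\<^sup>2) + b * (2 * s * t)\<bar> \<le> R" if st: "s\<^sup>2 + t\<^sup>2 = 1" for s t :: real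
  proof -
    have "(d * (s\<^sup>2 - t\<^sup>2) + b * (2 * s * t))\<^sup>2
        + (d * (2 * s * t) - b * (s\<^sup>2 - t\<^sup>2))\<^sup>2 = (d\<^sup>2 + b\<^sup>2) * (s\<^sup>2 + t\<^sup>2)\<^sup>2"
      by (simp add: power2_eq_square algebra_simps)
    then have "(d * (s\<^sup>2 - t\<^sup>2) + b * (2 * s * t))\<^sup>2 \<le> R\<^sup>2"
      using st R(1) by (simp) (metis add.commute le_add_same_cancel2 zero_le_power2)
    then show ?thesis using R(2) abs_le_square_iff[of _ R] by auto
  qed
  \<comment> \<open>the maximum is attained at the angle \<open>\<theta>/2\<close>, the minimum at a right angle to it\<close>
  obtain \<theta> where \<theta>: "d = R * cos \<theta>" "b = R * sin \<theta>"
  proof (cases "R = 0")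
    case True
    then have "d\<^sup>2 + b\<^sup>2 = 0" using R(1) by simp
    then have "d = 0" "b = 0" by (simp_all only: sum_power2_eq_zero_iff)
    then show ?thesis using True that[of 0] by simp
  next
    case False
    then have "(d / R)\<^sup>2 + (b / R)\<^sup>2 = 1"
      using R(1) by (metis add_divide_distrib divide_self power_divide power_not_zero)
    from sincos_total_2pi[OF this] show ?thesis using that False by (metis nonzero_mult_div_cancel_left times_divide_eq_right)
  qed
  have att: "m + R \<in> Q" "m - R \<in> Q"
  proof -
    have cs: "(cos (\<theta>/2))\<^sup>2 - (sin (\<theta>/2))\<^sup>2 = cos \<theta>" "2 * cos (\<theta>/2) * sin (\<theta>/2) = sin \<theta>"
      using cos_double[of "\<theta>/2"] sin_double[of "\<theta>/2"] by (simp_all add: mult.commute mult.left_commute)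
    have one: "(cos (\<theta>/2))\<^sup>2 + (sin (\<theta>/2))\<^sup>2 = 1" "(- sin (\<theta>/2))\<^sup>2 + (cos (\<theta>/2))\<^sup>2 = 1" by simp_all
    have RR: "d * cos \<theta> + b * sin \<theta> = R"
      using sin_cos_squared_add[of \<theta>] unfolding \<theta> by (simp add: power2_eq_square algebra_simps flip: distrib_left)
    have "a * (cos (\<theta>/2))\<^sup>2 + 2 * b * cos (\<theta>/2) * sin (\<theta>/2) + c * (sin (\<theta>/2))\<^sup>2 = m + R"
      using form[OF one(1)] cs RR by simp
    then show "m + R \<in> Q" unfolding Q_def using one(1) by (intro CollectI exI[of _ "cos (\<theta>/2)"] exI[of _ "sin (\<theta>/2)"]) simp
    have "d * ((- sin (\<theta>/2))\<^sup>2 - (cos (\<theta>/2))\<^sup>2) + b * (2 * (- sin (\<theta>/2)) * cos (\<theta>/2))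
        = - (d * ((cos (\<theta>/2))\<^sup>2 - (sin (\<theta>/2))\<^sup>2) + b * (2 * cos (\<theta>/2) * sin (\<theta>/2)))"
      by (simp add: algebra_simps)
    then have "a * (- sin (\<theta>/2))\<^sup>2 + 2 * b * (- sin (\<theta>/2)) * cos (\<theta>/2) + c * (cos (\<theta>/2))\<^sup>2 = m - R"
      using form[OF one(2)] cs RR by simp
    then show "m - R \<in> Q" unfolding Q_def using one(2) by (intro CollectI exI[of _ "- sin (\<theta>/2)"] exI[of _ "cos (\<theta>/2)"]) simp
  qed
  have bnd: "q \<le> m + R" "m - R \<le> q" if "q \<in> Q" for q
  proof -
    obtain s t where "q = a * s\<^sup>2 + 2 * b * s * t + c * t\<^sup>2" and st: "s\<^sup>2 + t\<^sup>2 = 1"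
      using \<open>q \<in> Q\<close> unfolding Q_def by blast
    then have "q = m + (d * (s\<^sup>2 - t\<^sup>2) + b * (2 * s * t))" using form[OF st] by simp
    then show "q \<le> m + R" "m - R \<le> q" using bd[OF st] by linarith+
  qed
  show "Sup Q = (a + c) / 2 + R" using att(1) bnd(1) by (intro cSup_eq_maximum) (auto simp: m_def)
  show "Inf Q = (a + c) / 2 - R" using att(2) bnd(2) by (intro cInf_eq_minimum) (auto simp: m_def)
qed

text \<open>The operator \<open>I - r W\<close>, with \<open>W\<close> the symmetric matrix with entries \<open>a, b, b, c\<close>, maps the unit circle into a
circle. Then its columns have equal length and are orthogonal, and both conditions contain the factor
\<open>2 - r (a + c)\<close>; the other factor vanishes for both only if \<open>W\<close> is a multiple of the identity. This is
where the symmetry of \<open>W\<close> matters: without it, \<open>I - r W\<close> could also be a rotation times a scalar.\<close>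

lemma equal_lengths_imp:
  fixes a b c r :: real
  assumes "r \<noteq> 0" and nonumb: "\<not> (a = c \<and> b = 0)"
    and eq: "\<And>s t. s\<^sup>2 + t\<^sup>2 = 1 \<Longrightarrow>
      (s * (1 - r * a) - t * (r * b))\<^sup>2 + (t * (1 - r * c) - s * (r * b))\<^sup>2 = k"
  shows "r * (a + c) = 2"
proof -
  have e1: "(1 - r * a)\<^sup>2 + (r * b)\<^sup>2 = k" using eq[of 1 0] by simp
  have e2: "(r * b)\<^sup>2 + (1 - r * c)\<^sup>2 = k" using eq[of 0 1] by simp
  \<comment> \<open>a third direction is needed to see that the columns are orthogonal; \<open>(3/5, 4/5)\<close> is a rational one\<close>
  have e3: "(3/5 * (1 - r * a) - 4/5 * (r * b))\<^sup>2 + (4/5 * (1 - r * c) - 3/5 * (r * b))\<^sup>2 = k"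
    using eq[of "3/5" "4/5"] by (simp add: power2_eq_square)
  have "(2 - r * (a + c)) * (r * (c - a)) = 0" using e1 e2 by (simp add: power2_eq_square algebra_simps)
  moreover have "(2 - r * (a + c)) * (r * b) = 0" using e1 e2 e3 by (simp add: power2_eq_square field_simps)
  ultimately show ?thesis using assms(1) nonumb by auto
qed

section \<open>Local parametrizations\<close>

locale surface_chart =
  fixes S :: "(real^3) set" and N :: "real^3 \<Rightarrow> real^3"
    and U :: "(real^2) set" and \<phi> :: "real^2 \<Rightarrow> real^3"
    and \<phi>' :: "real^2 \<Rightarrow> (real^2) \<Rightarrow>\<^sub>L (real^3)"
    and \<phi>'' :: "real^2 \<Rightarrow> (real^2) \<Rightarrow>\<^sub>L ((real^2) \<Rightarrow>\<^sub>L (real^3))"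
  assumes open_U: "open U"
    and \<phi>_S: "\<And>u. u \<in> U \<Longrightarrow> \<phi> u \<in> S"
    and d\<phi>: "\<And>u. u \<in> U \<Longrightarrow> (\<phi> has_derivative \<phi>' u) (at u)"
    and dd\<phi>: "\<And>u. u \<in> U \<Longrightarrow> (\<phi>' has_derivative \<phi>'' u) (at u)"
    and cont_\<phi>'': "continuous_on U \<phi>''"
    and inj_\<phi>': "\<And>u. u \<in> U \<Longrightarrow> inj (blinfun_apply (\<phi>' u))"
    and normal: "unit_normal_field S N"
begin

lemma cont_\<phi>': "continuous_on U \<phi>'"
  using dd\<phi> by (meson continuous_at_imp_continuous_on has_derivative_continuous)

lemma cont_\<phi>: "continuous_on U \<phi>"
  using d\<phi> by (meson continuous_at_imp_continuous_on has_derivative_continuous)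

lemma N_unit: "q \<in> S \<Longrightarrow> norm (N q) = 1"
  using normal by (simp add: unit_normal_field_def)

lemma coordinate_line:
  assumes "u \<in> U"
  obtains e where "e > 0" "\<And>t. \<bar>t\<bar> < e \<Longrightarrow> u + t *\<^sub>R w \<in> U"
    "\<And>t. \<bar>t\<bar> < e \<Longrightarrow> ((\<lambda>t. \<phi> (u + t *\<^sub>R w)) has_vector_derivative \<phi>' (u + t *\<^sub>R w) w) (at t)"
    "\<And>t. \<bar>t\<bar> < e \<Longrightarrow> ((\<lambda>t. \<phi>' (u + t *\<^sub>R w) w) has_vector_derivative \<phi>'' (u + t *\<^sub>R w) w w) (at t)"
    "continuous_on {-e<..<e} (\<lambda>t. \<phi>'' (u + t *\<^sub>R w) w w)"
proof -
  obtain d where d: "d > 0" "ball u d \<subseteq> U" using open_U assms openE by blast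
  define e where "e = d / (norm w + 1)"
  have e: "e > 0" using d by (simp add: e_def add_nonneg_pos)
  have inU: "u + t *\<^sub>R w \<in> U" if "\<bar>t\<bar> < e" for t
  proof -
    have "\<bar>t\<bar> * norm w \<le> \<bar>t\<bar> * (norm w + 1)" by (simp add: mult_left_mono)
    also have "\<dots> < d" using that by (simp add: e_def pos_less_divide_eq add_nonneg_pos)
    finally show ?thesis using d(2) by (auto simp: dist_norm subset_iff)
  qed
  have line: "((\<lambda>t. u + t *\<^sub>R w) has_derivative (\<lambda>h. h *\<^sub>R w)) (at t)" for t
    by (auto intro!: derivative_eq_intros)
  have 1: "((\<lambda>t. \<phi> (u + t *\<^sub>R w)) has_vector_derivative \<phi>' (u + t *\<^sub>R w) w) (at t)" if "\<bar>t\<bar> < e" for t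
    using has_derivative_compose[OF line d\<phi>[OF inU[OF that]]]
    by (simp add: has_vector_derivative_def blinfun.scaleR_right)
  have 2: "((\<lambda>t. \<phi>' (u + t *\<^sub>R w) w) has_vector_derivative \<phi>'' (u + t *\<^sub>R w) w w) (at t)" if "\<bar>t\<bar> < e" for t
  proof -
    have "((\<lambda>t. \<phi>' (u + t *\<^sub>R w)) has_derivative (\<lambda>h. h *\<^sub>R \<phi>'' (u + t *\<^sub>R w) w)) (at t)"
      using has_derivative_compose[OF line dd\<phi>[OF inU[OF that]]]
      by (simp add: blinfun.scaleR_right)
    from bounded_linear.has_derivative[OF blinfun.bounded_linear_left this, of w]
    show ?thesis by (simp add: has_vector_derivative_def blinfun.scaleR_left)
  qed
  have 3: "continuous_on {-e<..<e} (\<lambda>t. \<phi>'' (u + t *\<^sub>R w) w w)"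
  proof -
    have "continuous_on {-e<..<e} (\<lambda>t. \<phi>'' (u + t *\<^sub>R w))"
      by (rule continuous_on_compose2[OF cont_\<phi>'']) (auto intro!: continuous_intros inU)
    then show ?thesis by (intro continuous_intros)
  qed
  show thesis by (rule that[OF e inU 1 2 3])
qed

lemma range_tangent:
  assumes "u \<in> U" shows "\<phi>' u w \<in> tangent_space S (\<phi> u)"
proof -
  obtain e where e: "e > 0" and inU: "\<And>t. \<bar>t\<bar> < e \<Longrightarrow> u + t *\<^sub>R w \<in> U"
    and 1: "\<And>t. \<bar>t\<bar> < e \<Longrightarrow> ((\<lambda>t. \<phi> (u + t *\<^sub>R w)) has_vector_derivative \<phi>' (u + t *\<^sub>R w) w) (at t)"
    and 2: "\<And>t. \<bar>t\<bar> < e \<Longrightarrow> ((\<lambda>t. \<phi>' (u + t *\<^sub>R w) w) has_vector_derivative \<phi>'' (u + t *\<^sub>R w) w w) (at t)"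
    using coordinate_line[OF assms] by metis
  have "continuous_on {-e<..<e} (\<lambda>t. \<phi>' (u + t *\<^sub>R w) w)"
  proof (intro continuous_at_imp_continuous_on ballI)
    fix t assume "t \<in> {-e<..<e}"
    then have "\<bar>t\<bar> < e" by auto
    from has_vector_derivative_continuous[OF 2[OF this]] show "isCont (\<lambda>t. \<phi>' (u + t *\<^sub>R w) w) t" .
  qed
  then have "(\<lambda>t. \<phi> (u + t *\<^sub>R w)) C1_differentiable_on {-e<..<e}"
    unfolding C1_differentiable_on_def using 1 by (intro exI[of _ "\<lambda>t. \<phi>' (u + t *\<^sub>R w) w"]) auto
  moreover have "(\<lambda>t. \<phi> (u + t *\<^sub>R w)) ` {-e<..<e} \<subseteq> S" using inU \<phi>_S by auto
  ultimately show ?thesis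
    unfolding tangent_space_def using e 1[of 0]
    by (intro CollectI exI[of _ e] conjI exI[of _ "\<lambda>t. \<phi> (u + t *\<^sub>R w)"]) auto
qed

lemma normal_orthogonal: "u \<in> U \<Longrightarrow> N (\<phi> u) \<bullet> \<phi>' u w = 0"
  using range_tangent \<phi>_S normal by (auto simp: unit_normal_field_def)

text \<open>The inclusion \<open>\<subseteq>\<close> is clear, and both sides have dimension 2.\<close>

lemma range_eq:
  assumes "u \<in> U"
  shows "range (blinfun_apply (\<phi>' u)) = {x. N (\<phi> u) \<bullet> x = 0}"
proof (rule subspace_dim_equal)
  have lin: "linear (blinfun_apply (\<phi>' u))" by (simp add: blinfun.bounded_linear_right bounded_linear.linear)
  show "subspace (range (blinfun_apply (\<phi>' u)))" using lin by (simp add: linear_subspace_image)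
  show "subspace {x. N (\<phi> u) \<bullet> x = 0}" by (rule subspace_hyperplane)
  show "range (blinfun_apply (\<phi>' u)) \<subseteq> {x. N (\<phi> u) \<bullet> x = 0}" using normal_orthogonal[OF assms] by auto
  have "dim (range (blinfun_apply (\<phi>' u))) = dim (UNIV :: (real^2) set)"
    using lin inj_\<phi>'[OF assms] by (intro dim_image_eq) auto
  moreover have "N (\<phi> u) \<noteq> 0" using N_unit[OF \<phi>_S[OF assms]] by auto
  ultimately show "dim {x. N (\<phi> u) \<bullet> x = 0} \<le> dim (range (blinfun_apply (\<phi>' u)))"
    by (simp add: dim_hyperplane)
qed

lemma tangent_space_eq:
  assumes "u \<in> U"
  shows "tangent_space S (\<phi> u) = {v. N (\<phi> u) \<bullet> v = 0}"
proof
  show "tangent_space S (\<phi> u) \<subseteq> {v. N (\<phi> u) \<bullet> v = 0}"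
    using normal \<phi>_S[OF assms] by (auto simp: unit_normal_field_def)
  show "{v. N (\<phi> u) \<bullet> v = 0} \<subseteq> tangent_space S (\<phi> u)"
  proof
    fix v assume "v \<in> {v. N (\<phi> u) \<bullet> v = 0}"
    then have "v \<in> range (blinfun_apply (\<phi>' u))" by (simp only: range_eq[OF assms])
    then show "v \<in> tangent_space S (\<phi> u)" using range_tangent[OF assms] by auto
  qed
qed

lemma unit_speed_curve_exists:
  assumes u: "u \<in> U" and v: "N (\<phi> u) \<bullet> v = 0" "norm v = 1"
  shows "\<exists>l \<gamma>. unit_speed_curve S l \<gamma> \<and> \<gamma> 0 = \<phi> u \<and> time_deriv l \<gamma> 0 = v"
proof -
  have "v \<in> range (blinfun_apply (\<phi>' u))" using v(1) by (simp only: range_eq[OF u] mem_Collect_eq)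
  then obtain w where w: "\<phi>' u w = v" by blast
  obtain e where e: "e > 0" and inU: "\<And>t. \<bar>t\<bar> < e \<Longrightarrow> u + t *\<^sub>R w \<in> U"
    and 1: "\<And>t. \<bar>t\<bar> < e \<Longrightarrow> ((\<lambda>t. \<phi> (u + t *\<^sub>R w)) has_vector_derivative \<phi>' (u + t *\<^sub>R w) w) (at t)"
    and 2: "\<And>t. \<bar>t\<bar> < e \<Longrightarrow> ((\<lambda>t. \<phi>' (u + t *\<^sub>R w) w) has_vector_derivative \<phi>'' (u + t *\<^sub>R w) w w) (at t)"
    and 3: "continuous_on {-e<..<e} (\<lambda>t. \<phi>'' (u + t *\<^sub>R w) w w)"
    using coordinate_line[OF u] by metis
  have "\<phi>' (u + 0 *\<^sub>R w) w \<noteq> 0" using w v(2) by auto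
  from arclength_reparametrization[OF e 1 2 3 this]
  obtain l \<gamma> where "0 < l" "C2_upto l \<gamma>" "\<gamma> ` {0..l} \<subseteq> (\<lambda>t. \<phi> (u + t *\<^sub>R w)) ` {-e<..<e}"
    "\<gamma> 0 = \<phi> u" "time_deriv l \<gamma> 0 = v" "\<And>t. t \<in> {0..l} \<Longrightarrow> norm (time_deriv l \<gamma> t) = 1"
    using w v(2) by auto
  moreover have "(\<lambda>t. \<phi> (u + t *\<^sub>R w)) ` {-e<..<e} \<subseteq> S" using inU \<phi>_S by auto
  ultimately show ?thesis unfolding unit_speed_curve_def by blast
qed

text \<open>The field \<open>N \<circ> \<phi>\<close> agrees up to sign with the normalized cross product of the two coordinate
vectors, which is \<open>C\<^sup>1\<close>. By continuity of \<open>N\<close> the sign is constant on a ball.\<close>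

lemma normal_C1:
  assumes "u0 \<in> U"
  obtains r n' where "r > 0" "ball u0 r \<subseteq> U"
    "\<And>u. u \<in> ball u0 r \<Longrightarrow> ((\<lambda>u. N (\<phi> u)) has_derivative blinfun_apply (n' u)) (at u)"
    "continuous_on (ball u0 r) n'"
proof -
  obtain r where r: "r > 0" "ball u0 r \<subseteq> U" using open_U assms openE by blast
  define a where "a u = \<phi>' u (axis 1 1)" for u
  define b where "b u = \<phi>' u (axis 2 1)" for u
  define c where "c u = cross3 (a u) (b u)" for u
  have c_nz: "c u \<noteq> 0" if "u \<in> U" for u
  proof
    have eq: "x = y" if "\<phi>' u x = \<phi>' u y" for x y using inj_\<phi>'[OF \<open>u \<in> U\<close>] that by (simp add: inj_def)
    have nz: "a u \<noteq> 0" "b u \<noteq> 0"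
      using eq[of "axis 1 1" 0] eq[of "axis 2 1" 0] unfolding a_def b_def by (auto simp: axis_eq_0_iff)
    assume "c u = 0"
    then obtain k where "b u = k *\<^sub>R a u"
      using nz unfolding c_def cross_eq_0 collinear_lemma by blast
    then have "\<phi>' u (axis 2 1) = \<phi>' u (k *\<^sub>R axis 1 1)" by (simp add: a_def b_def blinfun.scaleR_right)
    then have "axis 2 1 $ (2::2) = (k *\<^sub>R axis 1 (1::real)) $ (2::2)" using eq by metis
    then show False by (simp add: axis_def)
  qed
  define n where "n u = c u /\<^sub>R norm (c u)" for u
  define s where "s u = N (\<phi> u) \<bullet> n u" for u
  have n_unit: "norm (n u) = 1" if "u \<in> U" for u using c_nz[OF that] by (simp add: n_def)
  have s_sq: "(s u)\<^sup>2 = 1" if "u \<in> U" for u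
  proof -
    have "cross3 (N (\<phi> u)) (c u) = (N (\<phi> u) \<bullet> b u) *\<^sub>R a u - (N (\<phi> u) \<bullet> a u) *\<^sub>R b u"
      by (simp add: c_def Lagrange)
    also have "\<dots> = 0" using normal_orthogonal[OF that] by (simp add: a_def b_def)
    finally have "(N (\<phi> u) \<bullet> c u)\<^sup>2 = (norm (c u))\<^sup>2"
      using norm_cross_dot[of "N (\<phi> u)" "c u"] N_unit[OF \<phi>_S[OF that]] by simp
    then show ?thesis using c_nz[OF that] by (simp add: s_def n_def power_mult_distrib power_divide divide_inverse[symmetric] field_simps)
  qed
  have N_eq: "N (\<phi> u) = s u *\<^sub>R n u" if "u \<in> U" for u
  proof -
    have "(norm (N (\<phi> u) - s u *\<^sub>R n u))\<^sup>2 = (norm (N (\<phi> u)))\<^sup>2 - 2 * s u * (N (\<phi> u) \<bullet> n u) + (s u)\<^sup>2 * (norm (n u))\<^sup>2"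
      by (simp add: power2_norm_eq_inner inner_diff_left inner_diff_right inner_commute power2_eq_square[of "s u"] algebra_simps)
    also have "\<dots> = 0" using n_unit[OF that] N_unit[OF \<phi>_S[OF that]] s_sq[OF that]
      by (simp add: s_def[symmetric] power2_eq_square)
    finally show ?thesis by simp
  qed
  have cont_ab: "continuous_on U a" "continuous_on U b"
    unfolding a_def b_def by (intro continuous_intros cont_\<phi>')+
  then have cont_c: "continuous_on U c" unfolding c_def by (intro continuous_on_cross)
  have cont_n: "continuous_on U n"
    unfolding n_def using c_nz by (intro continuous_intros cont_c) auto
  have "continuous_on S N" using normal by (simp add: unit_normal_field_def)
  then have "continuous_on U (\<lambda>u. N (\<phi> u))"
    by (rule continuous_on_compose2[OF _ cont_\<phi>]) (use \<phi>_S in auto)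
  then have "continuous_on U s" unfolding s_def by (intro continuous_intros cont_n)
  then have cs: "continuous_on (ball u0 r) s" using r continuous_on_subset by blast
  have "s u = 1 \<or> s u = -1" if "u \<in> U" for u using s_sq[OF that] by (simp add: power2_eq_1_iff)
  then have "s ` ball u0 r \<subseteq> {1, -1}" using r by blast
  then have "finite (s ` ball u0 r)" using finite_subset by blast
  then have "s constant_on ball u0 r"
    by (intro continuous_finite_range_constant cs connected_ball)
  then obtain \<sigma> where \<sigma>: "\<And>u. u \<in> ball u0 r \<Longrightarrow> s u = \<sigma>" unfolding constant_on_def by blast
  define c' where "c' u w = cross3 (a u) (\<phi>'' u w (axis 2 1)) + cross3 (\<phi>'' u w (axis 1 1)) (b u)" for u w
  define d where "d u w = \<sigma> *\<^sub>R (c' u w /\<^sub>R norm (c u) - (c u \<bullet> c' u w / norm (c u) ^ 3) *\<^sub>R c u)" for u w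
  have dc: "(c has_derivative c' u) (at u)" if "u \<in> U" for u
  proof -
    have "(a has_derivative (\<lambda>w. \<phi>'' u w (axis 1 1))) (at u)" "(b has_derivative (\<lambda>w. \<phi>'' u w (axis 2 1))) (at u)"
      unfolding a_def b_def
      using bounded_linear.has_derivative[OF blinfun.bounded_linear_left dd\<phi>[OF that]] by auto
    from bounded_bilinear.FDERIV[OF bounded_bilinear_cross this]
    show ?thesis unfolding c_def[abs_def] c'_def[abs_def] .
  qed
  have dN: "((\<lambda>u. N (\<phi> u)) has_derivative d u) (at u)" if "u \<in> ball u0 r" for u
  proof (rule has_derivative_transform_within_open)
    have u: "u \<in> U" using that r by auto
    show "((\<lambda>u. \<sigma> *\<^sub>R n u) has_derivative d u) (at u)"
      unfolding n_def d_def[abs_def]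
      using has_derivative_normalize[OF dc[OF u] c_nz[OF u]] by (rule has_derivative_scaleR_right)
    show "\<sigma> *\<^sub>R n v = N (\<phi> v)" if "v \<in> ball u0 r" for v
      using N_eq \<sigma> that r(2) by (metis subsetD)
  qed (use that in auto)
  have d_app: "blinfun_apply (Blinfun (d u)) = d u" if "u \<in> ball u0 r" for u
    using dN[OF that] by (simp add: bounded_linear_Blinfun_apply has_derivative_bounded_linear)
  have "continuous_on (ball u0 r) (\<lambda>u. Blinfun (d u))"
  proof (rule continuous_on_blinfun_componentwise)
    fix w :: "real^2"
    have cu: "continuous_on (ball u0 r) a" "continuous_on (ball u0 r) b" "continuous_on (ball u0 r) c"
      "continuous_on (ball u0 r) \<phi>''"
      using cont_ab cont_c cont_\<phi>'' r continuous_on_subset by blast+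
    have "continuous_on (ball u0 r) (\<lambda>u. c' u w)"
      unfolding c'_def by (intro continuous_intros continuous_on_cross cu)
    then have "continuous_on (ball u0 r) (\<lambda>u. d u w)"
      unfolding d_def using c_nz r by (intro continuous_intros cu) auto
    then show "continuous_on (ball u0 r) (\<lambda>u. Blinfun (d u) w)"
      by (rule continuous_on_eq) (simp add: d_app)
  qed
  with dN d_app r show thesis by (intro that[of r "\<lambda>u. Blinfun (d u)"]) simp_all
qed

text \<open>Differentiating \<open>N \<bullet> \<phi>' w = 0\<close> in the direction \<open>z\<close> expresses both sides through the second derivative
of \<open>\<phi>\<close>, which is symmetric.\<close>

lemma second_form_symmetric:
  assumes u: "u \<in> U" and dN: "((\<lambda>u. N (\<phi> u)) has_derivative n') (at u)"
  shows "n' w \<bullet> \<phi>' u z = n' z \<bullet> \<phi>' u w"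
proof -
  have *: "n' z \<bullet> \<phi>' u w + N (\<phi> u) \<bullet> \<phi>'' u z w = 0" for z w
  proof -
    have "((\<lambda>u. \<phi>' u w) has_derivative (\<lambda>z. \<phi>'' u z w)) (at u)"
      using bounded_linear.has_derivative[OF blinfun.bounded_linear_left dd\<phi>[OF u]] by auto
    from has_derivative_inner[OF dN this]
    have "((\<lambda>u. N (\<phi> u) \<bullet> \<phi>' u w) has_derivative (\<lambda>z. N (\<phi> u) \<bullet> \<phi>'' u z w + n' z \<bullet> \<phi>' u w)) (at u)" .
    moreover have "((\<lambda>u. N (\<phi> u) \<bullet> \<phi>' u w) has_derivative (\<lambda>z. 0)) (at u)"
    proof (rule has_derivative_transform_within_open)
      show "((\<lambda>u. 0) has_derivative (\<lambda>z. 0)) (at u)" by simp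
      show "0 = N (\<phi> v) \<bullet> \<phi>' v w" if "v \<in> U" for v using normal_orthogonal[OF that] by simp
    qed (use u open_U in auto)
    ultimately have "(\<lambda>z. N (\<phi> u) \<bullet> \<phi>'' u z w + n' z \<bullet> \<phi>' u w) = (\<lambda>z. 0)"
      by (rule has_derivative_unique)
    then show ?thesis by (simp add: fun_eq_iff add.commute)
  qed
  define m where "m = N (\<phi> u)"
  define f' where "f' v = blinfun_inner_right m o\<^sub>L \<phi>' v" for v
  have "bounded_linear (\<lambda>z. blinfun_inner_right m o\<^sub>L \<phi>'' u z)"
    by (intro bounded_linear_intros)
  then have bl: "blinfun_apply (Blinfun (\<lambda>z. blinfun_inner_right m o\<^sub>L \<phi>'' u z)) = (\<lambda>z. blinfun_inner_right m o\<^sub>L \<phi>'' u z)"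
    by (rule bounded_linear_Blinfun_apply)
  have "Blinfun (\<lambda>z. blinfun_inner_right m o\<^sub>L \<phi>'' u z) w z = Blinfun (\<lambda>z. blinfun_inner_right m o\<^sub>L \<phi>'' u z) z w"
  proof (rule second_derivative_symmetric[OF open_U u, of "\<lambda>v. m \<bullet> \<phi> v" f'])
    fix v assume "v \<in> U"
    from has_derivative_inner_right[OF d\<phi>[OF this], of m]
    show "((\<lambda>v. m \<bullet> \<phi> v) has_derivative blinfun_apply (f' v)) (at v)"
      by (rule has_derivative_eq_rhs) (auto simp: f'_def)
  next
    have "(f' has_derivative (\<lambda>z. blinfun_inner_right m o\<^sub>L \<phi>'' u z)) (at u)"
      unfolding f'_def[abs_def]
      using bounded_linear.has_derivative[OF bounded_bilinear.bounded_linear_right[OF bounded_bilinear_blinfun_compose] dd\<phi>[OF u]]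
      by auto
    then show "(f' has_derivative blinfun_apply (Blinfun (\<lambda>z. blinfun_inner_right m o\<^sub>L \<phi>'' u z))) (at u)"
      by (simp add: bl)
  qed
  then have "N (\<phi> u) \<bullet> \<phi>'' u w z = N (\<phi> u) \<bullet> \<phi>'' u z w" by (simp add: bl flip: m_def)
  with *[of w z] *[of z w] show ?thesis by simp
qed

end

section \<open>Projecting space onto the surface\<close>

text \<open>Near \<open>p\<close> the map \<open>R\<close> projects space onto \<open>S\<close> along the line spanned by \<open>N p\<close> (this is what
\<open>R_inner\<close> says), and \<open>L\<close> is the derivative of the extension \<open>N \<circ> R\<close> of the normal field. At points of \<open>S\<close> the
restriction of \<open>L\<close> to the tangent plane is the differential of \<open>N\<close>, the negative of the shape operator.\<close>

locale surface_patch =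
  fixes S :: "(real^3) set" and N :: "real^3 \<Rightarrow> real^3" and p :: "real^3"
    and V :: "(real^3) set" and R :: "real^3 \<Rightarrow> real^3"
    and D L :: "real^3 \<Rightarrow> (real^3) \<Rightarrow>\<^sub>L (real^3)"
  assumes open_V: "open V" and p_V: "p \<in> V" and p_S: "p \<in> S"
    and cont_N: "continuous_on S N"
    and N_unit: "\<And>q. q \<in> S \<Longrightarrow> norm (N q) = 1"
    and tangent_space_eq: "\<And>q. q \<in> S \<Longrightarrow> tangent_space S q = {v. N q \<bullet> v = 0}"
    and R_S: "\<And>q. q \<in> V \<Longrightarrow> R q \<in> S"
    and R_id: "\<And>q. q \<in> V \<Longrightarrow> q \<in> S \<Longrightarrow> R q = q"
    and R_inner: "\<And>q e. q \<in> V \<Longrightarrow> N p \<bullet> e = 0 \<Longrightarrow> R q \<bullet> e = q \<bullet> e"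
    and dR: "\<And>q. q \<in> V \<Longrightarrow> (R has_derivative D q) (at q)"
    and D_tangent: "\<And>q z. q \<in> V \<Longrightarrow> N (R q) \<bullet> D q z = 0"
    and dNR: "\<And>q. q \<in> V \<Longrightarrow> ((\<lambda>q. N (R q)) has_derivative L q) (at q)"
    and cont_L: "continuous_on V L"
    and L_symmetric: "\<And>q x y. q \<in> V \<Longrightarrow> q \<in> S \<Longrightarrow> N q \<bullet> x = 0 \<Longrightarrow> N q \<bullet> y = 0 \<Longrightarrow> L q x \<bullet> y = L q y \<bullet> x"
    and unit_speed_exists: "\<And>q v. q \<in> S \<Longrightarrow> N q \<bullet> v = 0 \<Longrightarrow> norm v = 1 \<Longrightarrow>
        \<exists>l \<gamma>. unit_speed_curve S l \<gamma> \<and> \<gamma> 0 = q \<and> time_deriv l \<gamma> 0 = v"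

lemma surface_chart_exists:
  assumes "C2_surface S" "unit_normal_field S N" "p \<in> S"
  obtains U V \<phi> \<psi> \<phi>' \<phi>'' where "surface_chart S N U \<phi> \<phi>' \<phi>''" "open V" "p \<in> V" "homeomorphism U (S \<inter> V) \<phi> \<psi>"
proof -
  obtain U :: "(real^2) set" and V \<phi> \<psi> where 1: "open U" "open V" "p \<in> V" "C2_on \<phi> U" "homeomorphism U (S \<inter> V) \<phi> \<psi>"
    and inj: "\<forall>u\<in>U. inj (frechet_derivative \<phi> (at u))"
    using assms(1,3) unfolding C2_surface_def by meson
  obtain \<phi>' :: "real^2 \<Rightarrow> (real^2) \<Rightarrow>\<^sub>L (real^3)" and \<phi>'' where
    2: "\<forall>x\<in>U. (\<phi> has_derivative blinfun_apply (\<phi>' x)) (at x)"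
       "\<forall>x\<in>U. (\<phi>' has_derivative blinfun_apply (\<phi>'' x)) (at x)" "continuous_on U \<phi>''"
    using 1(4) unfolding C2_on_def by blast
  have "surface_chart S N U \<phi> \<phi>' \<phi>''"
  proof
    fix u assume u: "u \<in> U"
    show "\<phi> u \<in> S" using u 1(5) by (auto simp: homeomorphism_def)
    show "inj (blinfun_apply (\<phi>' u))"
      using inj u 2(1) frechet_derivative_at by metis
  qed (use 1 2 assms in auto)
  with 1 show thesis using that by blast
qed

text \<open>With orthonormal tangent vectors \<open>e1, e2\<close> at \<open>p\<close>, let \<open>\<Lambda> x = (x \<bullet> e1, x \<bullet> e2)\<close>. Then \<open>\<Lambda> \<circ> \<phi>\<close> has an
invertible derivative at the parameter of \<open>p\<close>; if \<open>G\<close> is its local inverse, \<open>R = \<phi> \<circ> G \<circ> \<Lambda>\<close> is the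
projection along \<open>N p\<close>. That \<open>\<phi>\<close> is a homeomorphism onto an open piece of \<open>S\<close> ensures that \<open>R\<close> fixes every
point of \<open>S\<close> near \<open>p\<close>, not only those with parameter near that of \<open>p\<close>.\<close>

lemma surface_patch_exists:
  assumes S: "C2_surface S" and N: "unit_normal_field S N" and p: "p \<in> S"
  obtains V R D L where "surface_patch S N p V R D L"
proof -
  obtain U V0 \<phi> \<psi> \<phi>' \<phi>'' where "surface_chart S N U \<phi> \<phi>' \<phi>''" and V0: "open V0" "p \<in> V0"
    and hom: "homeomorphism U (S \<inter> V0) \<phi> \<psi>"
    using surface_chart_exists[OF assms] by metis
  then interpret surface_chart S N U \<phi> \<phi>' \<phi>'' by simp
  define u0 where "u0 = \<psi> p"
  have u0: "u0 \<in> U" "\<phi> u0 = p" using hom p V0 unfolding u0_def homeomorphism_def by auto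
  obtain r n' where r: "r > 0" "ball u0 r \<subseteq> U"
    and dn: "\<And>u. u \<in> ball u0 r \<Longrightarrow> ((\<lambda>u. N (\<phi> u)) has_derivative blinfun_apply (n' u)) (at u)"
    and cn: "continuous_on (ball u0 r) n'"
    using normal_C1[OF u0(1)] by metis
  let ?B = "ball u0 r"
  have Np: "norm (N p) = 1" using N_unit p by simp
  obtain e1 e2 where e: "norm e1 = 1" "norm e2 = 1" "e1 \<bullet> e2 = 0" "N p \<bullet> e1 = 0" "N p \<bullet> e2 = 0"
    using tangent_plane_frame[OF Np] by metis
  define \<Lambda>0 :: "real^3 \<Rightarrow> real^2" where "\<Lambda>0 x = (x \<bullet> e1) *\<^sub>R axis 1 1 + (x \<bullet> e2) *\<^sub>R axis 2 1" for x
  define \<Lambda> where "\<Lambda> = Blinfun \<Lambda>0"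
  have "bounded_linear \<Lambda>0" unfolding \<Lambda>0_def[abs_def] by (intro bounded_linear_intros)
  then have \<Lambda>: "blinfun_apply \<Lambda> x = \<Lambda>0 x" for x unfolding \<Lambda>_def by (simp add: bounded_linear_Blinfun_apply)
  have \<Lambda>1: "\<Lambda> x $ 1 = x \<bullet> e1" and \<Lambda>2: "\<Lambda> x $ 2 = x \<bullet> e2" for x
    by (simp_all add: \<Lambda> \<Lambda>0_def axis_def)
  define F where "F u = \<Lambda> (\<phi> u)" for u
  define F' where "F' u = \<Lambda> o\<^sub>L \<phi>' u" for u
  have dF: "(F has_derivative F' u) (at u)" if "u \<in> ?B" for u
  proof -
    have "blinfun_apply (F' u) = (\<lambda>w. \<Lambda> (\<phi>' u w))" by (auto simp: F'_def)
    then show ?thesis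
      using bounded_linear.has_derivative[OF blinfun.bounded_linear_right d\<phi>[OF subsetD[OF r(2) that]], of \<Lambda>]
      by (simp add: F_def[abs_def])
  qed
  have cF: "continuous_on ?B F'"
    unfolding F'_def by (intro continuous_intros continuous_on_subset[OF cont_\<phi>' r(2)])
  have inj: "inj (blinfun_apply (F' u0))"
  proof (rule injI)
    fix x y assume "F' u0 x = F' u0 y"
    then have 0: "\<Lambda> (\<phi>' u0 (x - y)) = 0" by (simp add: F'_def blinfun.diff_right)
    define z where "z = \<phi>' u0 (x - y)"
    have "z \<bullet> e1 = 0" "z \<bullet> e2 = 0" using \<Lambda>1[of z] \<Lambda>2[of z] 0 by (simp_all add: z_def)
    moreover have "N p \<bullet> z = 0" using normal_orthogonal[OF u0(1)] u0(2) by (simp add: z_def)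
    ultimately have "z = 0" using frame_expansion[OF Np e(1-5), of z] by simp
    then show "x = y" using inj_\<phi>'[OF u0(1)] by (auto simp: z_def blinfun.diff_right inj_def)
  qed
  have "u0 \<in> ?B" using r by simp
  from C1_local_inverse[OF open_ball this dF cF inj]
  obtain U' W G G' where U': "open U'" "U' \<subseteq> ?B" "u0 \<in> U'" and W: "open W" "F u0 \<in> W"
    and FG: "homeomorphism U' W F G"
    and dG: "\<And>y. y \<in> W \<Longrightarrow> (G has_derivative blinfun_apply (G' y)) (at y)"
    and cG': "continuous_on W G'"
    and G'F: "\<And>y w. y \<in> W \<Longrightarrow> G' y (F' (G y) w) = w"
    by metis
  have "openin (top_of_set U) U'" using U'(1,2) r(2) by (auto simp: openin_open)
  from homeomorphism_imp_open_map[OF hom this]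
  obtain T where T: "open T" "\<phi> ` U' = (S \<inter> V0) \<inter> T" by (auto simp: openin_open)
  define V where "V = V0 \<inter> T \<inter> blinfun_apply \<Lambda> -` W"
  define R where "R q = \<phi> (G (\<Lambda> q))" for q
  define D where "D q = \<phi>' (G (\<Lambda> q)) o\<^sub>L G' (\<Lambda> q) o\<^sub>L \<Lambda>" for q
  define L where "L q = n' (G (\<Lambda> q)) o\<^sub>L G' (\<Lambda> q) o\<^sub>L \<Lambda>" for q
  have GW: "G y \<in> U'" "F (G y) = y" if "y \<in> W" for y using FG that by (auto simp: homeomorphism_def)
  have VW: "\<Lambda> q \<in> W" if "q \<in> V" for q using that by (simp add: V_def)
  have GB: "G (\<Lambda> q) \<in> ?B" "G (\<Lambda> q) \<in> U" if "q \<in> V" for q using GW[OF VW[OF that]] U' r by auto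
  have retract: "R q = q" if "q \<in> V" "q \<in> S" for q
  proof -
    have "q \<in> \<phi> ` U'" using that T(2) by (auto simp: V_def)
    then obtain u where u: "u \<in> U'" "q = \<phi> u" by auto
    then have "G (\<Lambda> q) = u" using FG by (simp add: homeomorphism_def F_def[symmetric])
    then show ?thesis using u by (simp add: R_def)
  qed
  have dG\<Lambda>: "((\<lambda>q. G (\<Lambda> q)) has_derivative (\<lambda>z. G' (\<Lambda> q) (\<Lambda> z))) (at q)" if "q \<in> V" for q
    using has_derivative_compose[OF bounded_linear_imp_has_derivative[OF blinfun.bounded_linear_right] dG[OF VW[OF that]]] .
  have cG\<Lambda>: "continuous_on V (\<lambda>q. G (\<Lambda> q))"
    using dG\<Lambda> by (meson continuous_at_imp_continuous_on has_derivative_continuous)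
  have chart_at: "\<exists>U1 \<phi>1 \<phi>1' \<phi>1'' u1. surface_chart S N U1 \<phi>1 \<phi>1' \<phi>1'' \<and> u1 \<in> U1 \<and> \<phi>1 u1 = q"
    if q: "q \<in> S" for q
  proof -
    obtain U1 V1 \<phi>1 \<psi>1 \<phi>1' \<phi>1'' where c: "surface_chart S N U1 \<phi>1 \<phi>1' \<phi>1''" "q \<in> V1"
      "homeomorphism U1 (S \<inter> V1) \<phi>1 \<psi>1"
      using surface_chart_exists[OF S N q] by metis
    then have "\<psi>1 q \<in> U1" "\<phi>1 (\<psi>1 q) = q" using q by (auto simp: homeomorphism_def)
    with c(1) show ?thesis by blast
  qed
  have "surface_patch S N p V R D L"
  proof
    show "open V" unfolding V_def using V0 T W
      by (intro open_Int open_vimage continuous_intros) auto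
    show "p \<in> V" using V0 T(2) U'(3) u0 W(2) by (auto simp: V_def F_def)
    show "p \<in> S" by (rule p)
    show "norm (N q) = 1" if "q \<in> S" for q using N_unit that by simp
    show "tangent_space S q = {v. N q \<bullet> v = 0}" if q: "q \<in> S" for q
      using chart_at[OF q] surface_chart.tangent_space_eq by metis
    show "\<exists>l \<gamma>. unit_speed_curve S l \<gamma> \<and> \<gamma> 0 = q \<and> time_deriv l \<gamma> 0 = v"
      if "q \<in> S" "N q \<bullet> v = 0" "norm v = 1" for q v
      using chart_at[OF \<open>q \<in> S\<close>] surface_chart.unit_speed_curve_exists that(2,3) by metis
    show "continuous_on S N" using N by (simp add: unit_normal_field_def)
    show "R q = q" if "q \<in> V" "q \<in> S" for q using retract that .
    show "continuous_on V L"
      unfolding L_def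
      by (intro continuous_intros continuous_on_compose2[OF cn cG\<Lambda>] continuous_on_compose2[OF cG'])
        (use GB VW in auto)
    fix q assume q: "q \<in> V"
    show "R q \<in> S" using \<phi>_S GB[OF q] by (simp add: R_def)
    show "R q \<bullet> v = q \<bullet> v" if v: "N p \<bullet> v = 0" for v
    proof -
      have "\<Lambda> (R q) = \<Lambda> q" using GW[OF VW[OF q]] by (simp add: R_def F_def)
      then have "R q \<bullet> e1 = q \<bullet> e1" "R q \<bullet> e2 = q \<bullet> e2" using \<Lambda>1 \<Lambda>2 by metis+
      moreover have "v = (v \<bullet> e1) *\<^sub>R e1 + (v \<bullet> e2) *\<^sub>R e2" using frame_expansion[OF Np e(1-5) v] .
      ultimately show ?thesis by (metis inner_add_right inner_scaleR_right)
    qed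
    show "(R has_derivative blinfun_apply (D q)) (at q)"
      using has_derivative_compose[OF dG\<Lambda>[OF q] d\<phi>[OF GB(2)[OF q]]]
      unfolding R_def[abs_def] by (rule has_derivative_eq_rhs) (auto simp: D_def)
    show "((\<lambda>q. N (R q)) has_derivative blinfun_apply (L q)) (at q)"
      using has_derivative_compose[OF dG\<Lambda>[OF q] dn[OF GB(1)[OF q]]]
      unfolding R_def[abs_def] by (rule has_derivative_eq_rhs) (auto simp: L_def)
    show "N (R q) \<bullet> D q z = 0" for z
      using normal_orthogonal[OF GB(2)[OF q]] by (simp add: R_def D_def)
    show "L q x \<bullet> y = L q y \<bullet> x" if qS: "q \<in> S" and xy: "N q \<bullet> x = 0" "N q \<bullet> y = 0" for x y
    proof -
      define u where "u = G (\<Lambda> q)"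
      have u: "u \<in> ?B" "u \<in> U" "\<phi> u = q" using GB[OF q] retract[OF q qS] by (auto simp: u_def R_def)
      have rg: "range (blinfun_apply (\<phi>' u)) = {x. N q \<bullet> x = 0}" using range_eq[OF u(2)] u(3) by simp
      have "x \<in> range (blinfun_apply (\<phi>' u))" "y \<in> range (blinfun_apply (\<phi>' u))"
        using xy by (simp_all only: rg mem_Collect_eq)
      then obtain x' y' where x': "x = \<phi>' u x'" "y = \<phi>' u y'" by blast
      have "L q (\<phi>' u w) = n' u w" for w
        using G'F[OF VW[OF q], of w] by (simp add: L_def u_def F'_def)
      then show ?thesis using second_form_symmetric[OF u(2) dn[OF u(1)], of x' y'] x' by simp
    qed
  qed
  then show thesis by (rule that)
qed

section \<open>Curvature and the velocity of the centre\<close>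

context surface_patch begin

lemma L_tangent:
  assumes "q \<in> V" shows "N (R q) \<bullet> L q z = 0"
proof -
  have "((\<lambda>q. N (R q) \<bullet> N (R q)) has_derivative (\<lambda>z. N (R q) \<bullet> L q z + L q z \<bullet> N (R q))) (at q)"
    using has_derivative_inner[OF dNR[OF assms] dNR[OF assms]] .
  moreover have "((\<lambda>q. N (R q) \<bullet> N (R q)) has_derivative (\<lambda>z. 0)) (at q)"
  proof (rule has_derivative_transform_within_open)
    show "((\<lambda>u. 1) has_derivative (\<lambda>z. 0)) (at q)" by simp
    show "1 = N (R x) \<bullet> N (R x)" if "x \<in> V" for x
      using N_unit[OF R_S[OF that]] by (simp add: dot_square_norm)
  qed (use assms open_V in auto)
  ultimately have "(\<lambda>z. N (R q) \<bullet> L q z + L q z \<bullet> N (R q)) = (\<lambda>z. 0)"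
    by (rule has_derivative_unique)
  then show ?thesis by (simp add: fun_eq_iff inner_commute)
qed

lemma short_arc:
  assumes "unit_speed_curve S l \<gamma>" "\<gamma> 0 \<in> V"
  obtains \<epsilon> where "0 < \<epsilon>" "\<epsilon> \<le> l" "\<gamma> ` {0..\<epsilon>} \<subseteq> S \<inter> V"
proof -
  have l: "0 < l" and C1: "C1_upto l \<gamma>" and sub: "\<gamma> ` {0..l} \<subseteq> S"
    using assms(1) by (auto simp: unit_speed_curve_def C2_upto_def)
  have "continuous_on {0..l} \<gamma>" by (rule C1_upto_continuous[OF C1])
  then obtain d where d: "d > 0" "\<And>t. t \<in> {0..l} \<Longrightarrow> dist t 0 < d \<Longrightarrow> \<gamma> t \<in> V"
  proof -
    obtain \<rho> where \<rho>: "\<rho> > 0" "ball (\<gamma> 0) \<rho> \<subseteq> V" using open_V assms(2) openE by blast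
    obtain d where "d > 0" "\<And>t. t \<in> {0..l} \<Longrightarrow> dist t 0 < d \<Longrightarrow> dist (\<gamma> t) (\<gamma> 0) < \<rho>"
      using \<open>continuous_on {0..l} \<gamma>\<close> l \<rho>(1) unfolding continuous_on_iff by (metis atLeastAtMost_iff less_eq_real_def)
    then show thesis using \<rho>(2) that[of d] by (auto simp: subset_iff dist_commute)
  qed
  define \<epsilon> where "\<epsilon> = min l (d / 2)"
  have "0 < \<epsilon>" "\<epsilon> \<le> l" "\<epsilon> < d" using l d(1) by (auto simp: \<epsilon>_def)
  moreover have "\<gamma> ` {0..\<epsilon>} \<subseteq> S \<inter> V"
  proof (intro subsetI, elim imageE)
    fix x t assume x: "x = \<gamma> t" "t \<in> {0..\<epsilon>}"
    then have "t \<in> {0..l}" "dist t 0 < d" using \<open>\<epsilon> \<le> l\<close> \<open>\<epsilon> < d\<close> by (auto simp: dist_real_def)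
    then show "x \<in> S \<inter> V" using d(2) sub x by auto
  qed
  ultimately show thesis using that by blast
qed

lemma normal_along_curve:
  assumes sub: "\<gamma> ` {0..\<epsilon>} \<subseteq> S \<inter> V" and t: "t \<in> {0..\<epsilon>}"
    and d: "(\<gamma> has_vector_derivative d) (at t within {0..\<epsilon>})"
  shows "((\<lambda>t. N (\<gamma> t)) has_vector_derivative L (\<gamma> t) d) (at t within {0..\<epsilon>})"
proof -
  have V: "\<gamma> t \<in> V" using sub t by auto
  have "((\<lambda>t. N (R (\<gamma> t))) has_vector_derivative L (\<gamma> t) d) (at t within {0..\<epsilon>})"
    using has_derivative_compose[OF d[unfolded has_vector_derivative_def] dNR[OF V]]
    by (simp add: has_vector_derivative_def blinfun.scaleR_right)
  then show ?thesis
    by (rule has_vector_derivative_transform[OF t, rotated]) (use sub R_id in force)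
qed

text \<open>The definition of the tangent space refers to two-sided curves, so it does not apply to the velocity
at an endpoint. Differentiating \<open>R \<circ> \<gamma> = \<gamma>\<close> instead shows that the velocity lies in the range of the
derivative of \<open>R\<close>.\<close>

lemma velocity_tangent:
  assumes \<epsilon>: "0 < \<epsilon>" and sub: "\<gamma> ` {0..\<epsilon>} \<subseteq> S \<inter> V" and t: "t \<in> {0..\<epsilon>}"
    and d: "(\<gamma> has_vector_derivative d) (at t within {0..\<epsilon>})"
  shows "N (\<gamma> t) \<bullet> d = 0"
proof -
  have V: "\<gamma> t \<in> V" "\<gamma> t \<in> S" using sub t by auto
  have "((\<lambda>t. R (\<gamma> t)) has_vector_derivative D (\<gamma> t) d) (at t within {0..\<epsilon>})"
    using has_derivative_compose[OF d[unfolded has_vector_derivative_def] dR[OF V(1)]]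
    by (simp add: has_vector_derivative_def blinfun.scaleR_right)
  then have "(\<gamma> has_vector_derivative D (\<gamma> t) d) (at t within {0..\<epsilon>})"
    by (rule has_vector_derivative_transform[OF t, rotated]) (use sub R_id in force)
  then have "D (\<gamma> t) d = d" using d time_deriv_eq t \<epsilon> by metis
  then show ?thesis using D_tangent[OF V(1), of d] R_id[OF V] by simp
qed

text \<open>Differentiate \<open>\<gamma>' \<bullet> N \<circ> \<gamma> = 0\<close> at time 0.\<close>

lemma normal_curvature_eq:
  assumes "unit_speed_curve S l \<gamma>" "\<gamma> 0 \<in> V"
  shows "time_deriv l (time_deriv l \<gamma>) 0 \<bullet> N (\<gamma> 0) = - (L (\<gamma> 0) (time_deriv l \<gamma> 0) \<bullet> time_deriv l \<gamma> 0)"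
proof -
  obtain \<epsilon> where \<epsilon>: "0 < \<epsilon>" "\<epsilon> \<le> l" "\<gamma> ` {0..\<epsilon>} \<subseteq> S \<inter> V" using short_arc[OF assms] .
  have C1: "C1_upto l \<gamma>" "C1_upto l (time_deriv l \<gamma>)"
    using assms(1) by (auto simp: unit_speed_curve_def C2_upto_def)
  have sub: "{0..\<epsilon>} \<subseteq> {0..l}" using \<epsilon>(2) by auto
  have d1: "(\<gamma> has_vector_derivative time_deriv l \<gamma> t) (at t within {0..\<epsilon>})" if "t \<in> {0..\<epsilon>}" for t
    using has_vector_derivative_within_subset[OF C1_uptoD[OF C1(1)] sub] that sub by blast
  have 0: "0 \<in> {0..\<epsilon>}" using \<epsilon> by simp
  have d2: "(time_deriv l \<gamma> has_vector_derivative time_deriv l (time_deriv l \<gamma>) 0) (at 0 within {0..\<epsilon>})"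
    using has_vector_derivative_within_subset[OF C1_uptoD[OF C1(2)] sub] 0 sub by blast
  have "((\<lambda>t. time_deriv l \<gamma> t \<bullet> N (\<gamma> t)) has_derivative
      (\<lambda>h. time_deriv l \<gamma> 0 \<bullet> (h *\<^sub>R L (\<gamma> 0) (time_deriv l \<gamma> 0))
         + (h *\<^sub>R time_deriv l (time_deriv l \<gamma>) 0) \<bullet> N (\<gamma> 0))) (at 0 within {0..\<epsilon>})"
    using has_derivative_inner[OF d2[unfolded has_vector_derivative_def]
      normal_along_curve[OF \<epsilon>(3) 0 d1[OF 0], unfolded has_vector_derivative_def]] .
  then have 1: "((\<lambda>t. time_deriv l \<gamma> t \<bullet> N (\<gamma> t)) has_vector_derivative
      time_deriv l \<gamma> 0 \<bullet> L (\<gamma> 0) (time_deriv l \<gamma> 0) + time_deriv l (time_deriv l \<gamma>) 0 \<bullet> N (\<gamma> 0))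
      (at 0 within {0..\<epsilon>})"
    by (simp add: has_vector_derivative_def algebra_simps)
  have 2: "((\<lambda>t. time_deriv l \<gamma> t \<bullet> N (\<gamma> t)) has_vector_derivative 0) (at 0 within {0..\<epsilon>})"
  proof (rule has_vector_derivative_transform[OF 0])
    show "time_deriv l \<gamma> t \<bullet> N (\<gamma> t) = 0" if "t \<in> {0..\<epsilon>}" for t
      using velocity_tangent[OF \<epsilon>(1,3) that d1[OF that]] by (simp add: inner_commute)
  qed simp
  from time_deriv_eq[OF 1 0 \<epsilon>(1)] time_deriv_eq[OF 2 0 \<epsilon>(1)]
  show ?thesis by (simp add: inner_commute)
qed

lemma initial_velocity_tangent:
  assumes "unit_speed_curve S l \<gamma>" "\<gamma> 0 \<in> V"
  shows "N (\<gamma> 0) \<bullet> time_deriv l \<gamma> 0 = 0" "norm (time_deriv l \<gamma> 0) = 1"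
proof -
  obtain \<epsilon> where \<epsilon>: "0 < \<epsilon>" "\<epsilon> \<le> l" "\<gamma> ` {0..\<epsilon>} \<subseteq> S \<inter> V" using short_arc[OF assms] .
  have C1: "C1_upto l \<gamma>" using assms(1) by (auto simp: unit_speed_curve_def C2_upto_def)
  have 0: "0 \<in> {0..l}" "0 \<in> {0..\<epsilon>}" using \<epsilon> by simp_all
  have sub: "{0..\<epsilon>} \<subseteq> {0..l}" using \<epsilon>(2) by auto
  from velocity_tangent[OF \<epsilon>(1,3) 0(2) has_vector_derivative_within_subset[OF C1_uptoD[OF C1 0(1)] sub]]
  show "N (\<gamma> 0) \<bullet> time_deriv l \<gamma> 0 = 0" .
  show "norm (time_deriv l \<gamma> 0) = 1" using assms(1) 0(1) by (auto simp: unit_speed_curve_def)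
qed

lemma normal_curvatures_eq:
  assumes "q \<in> V" "q \<in> S"
  shows "normal_curvatures S N q = {- (L q v \<bullet> v) | v. N q \<bullet> v = 0 \<and> norm v = 1}"
proof (intro set_eqI iffI)
  fix k assume "k \<in> normal_curvatures S N q"
  then obtain l \<gamma> where \<gamma>: "unit_speed_curve S l \<gamma>" "\<gamma> 0 = q" "k = time_deriv l (time_deriv l \<gamma>) 0 \<bullet> N q"
    unfolding normal_curvatures_def by blast
  then show "k \<in> {- (L q v \<bullet> v) | v. N q \<bullet> v = 0 \<and> norm v = 1}"
    using initial_velocity_tangent[OF \<gamma>(1)] normal_curvature_eq[OF \<gamma>(1)] assms by auto
next
  fix k assume "k \<in> {- (L q v \<bullet> v) | v. N q \<bullet> v = 0 \<and> norm v = 1}"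
  then obtain v where v: "k = - (L q v \<bullet> v)" "N q \<bullet> v = 0" "norm v = 1" by blast
  obtain l \<gamma> where \<gamma>: "unit_speed_curve S l \<gamma>" "\<gamma> 0 = q" "time_deriv l \<gamma> 0 = v"
    using unit_speed_exists[OF assms(2) v(2,3)] by blast
  then have "k = time_deriv l (time_deriv l \<gamma>) 0 \<bullet> N q"
    using normal_curvature_eq[OF \<gamma>(1)] assms(1) v(1) by simp
  then show "k \<in> normal_curvatures S N q" unfolding normal_curvatures_def using \<gamma> by blast
qed

context
  fixes q x y
  assumes q: "q \<in> V" "q \<in> S" and x: "norm x = 1" "N q \<bullet> x = 0" and y: "norm y = 1" "N q \<bullet> y = 0"
    and xy: "x \<bullet> y = 0"
begin

lemma unit_tangent_iff:
  "N q \<bullet> v = 0 \<and> norm v = 1 \<longleftrightarrow> (\<exists>s t. v = s *\<^sub>R x + t *\<^sub>R y \<and> s\<^sup>2 + t\<^sup>2 = 1)"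
proof -
  have o: "x \<bullet> x = 1" "y \<bullet> y = 1" "y \<bullet> x = 0" using x y xy by (simp_all add: dot_square_norm inner_commute)
  have n: "norm (s *\<^sub>R x + t *\<^sub>R y) = 1 \<longleftrightarrow> s\<^sup>2 + t\<^sup>2 = 1" for s t
    by (simp add: norm_eq_1 inner_add_left inner_add_right o xy power2_eq_square)
  show ?thesis
  proof
    assume v: "N q \<bullet> v = 0 \<and> norm v = 1"
    then have e: "v = (v \<bullet> x) *\<^sub>R x + (v \<bullet> y) *\<^sub>R y"
      using frame_expansion[OF N_unit[OF q(2)] x(1) y(1) xy x(2) y(2)] by simp
    then show "\<exists>s t. v = s *\<^sub>R x + t *\<^sub>R y \<and> s\<^sup>2 + t\<^sup>2 = 1" using n v by metis
  next
    assume "\<exists>s t. v = s *\<^sub>R x + t *\<^sub>R y \<and> s\<^sup>2 + t\<^sup>2 = 1"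
    then show "N q \<bullet> v = 0 \<and> norm v = 1" using n x y by (auto simp: inner_add_right)
  qed
qed

lemma L_form:
  "L q (s *\<^sub>R x + t *\<^sub>R y) \<bullet> (s *\<^sub>R x + t *\<^sub>R y)
    = (L q x \<bullet> x) * s\<^sup>2 + 2 * (L q x \<bullet> y) * s * t + (L q y \<bullet> y) * t\<^sup>2"
  using L_symmetric[OF q x(2) y(2)]
  by (simp add: blinfun.add_right blinfun.scaleR_right inner_add_left inner_add_right power2_eq_square algebra_simps)

lemma normal_curvatures_frame:
  "normal_curvatures S N q =
    {(- (L q x \<bullet> x)) * s\<^sup>2 + 2 * (- (L q x \<bullet> y)) * s * t + (- (L q y \<bullet> y)) * t\<^sup>2 | s t. s\<^sup>2 + t\<^sup>2 = 1}"
proof -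
  have "normal_curvatures S N q = {- (L q v \<bullet> v) | v. \<exists>s t. v = s *\<^sub>R x + t *\<^sub>R y \<and> s\<^sup>2 + t\<^sup>2 = 1}"
    unfolding normal_curvatures_eq[OF q] unit_tangent_iff ..
  also have "\<dots> = {- (L q (s *\<^sub>R x + t *\<^sub>R y) \<bullet> (s *\<^sub>R x + t *\<^sub>R y)) | s t. s\<^sup>2 + t\<^sup>2 = 1}" by blast
  finally show ?thesis unfolding L_form by (simp add: algebra_simps)
qed

lemma mean_curvature_frame: "mean_curvature S N q = - (L q x \<bullet> x + L q y \<bullet> y) / 2"
  unfolding mean_curvature_def principal_curvature1_def principal_curvature2_def
    normal_curvatures_frame quadratic_form_on_circle by (simp add: field_simps)

lemma umbilic_frame: "umbilic S N q \<longleftrightarrow> L q x \<bullet> x = L q y \<bullet> y \<and> L q x \<bullet> y = 0"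
proof -
  define a b c where "a = - (L q x \<bullet> x)" and "b = - (L q x \<bullet> y)" and "c = - (L q y \<bullet> y)"
  have "umbilic S N q \<longleftrightarrow> sqrt (((a - c) / 2)\<^sup>2 + b\<^sup>2) = 0"
    unfolding umbilic_def principal_curvature1_def principal_curvature2_def
      normal_curvatures_frame quadratic_form_on_circle a_def b_def c_def by (simp add: field_simps)
  also have "\<dots> \<longleftrightarrow> ((a - c) / 2)\<^sup>2 + b\<^sup>2 = 0" by (simp only: real_sqrt_eq_0_iff)
  also have "\<dots> \<longleftrightarrow> a = c \<and> b = 0" by (simp only: sum_power2_eq_zero_iff) simp
  finally show ?thesis by (auto simp: a_def b_def c_def)
qed

lemma L_frame:
  "L q x = (L q x \<bullet> x) *\<^sub>R x + (L q x \<bullet> y) *\<^sub>R y"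
  "L q y = (L q x \<bullet> y) *\<^sub>R x + (L q y \<bullet> y) *\<^sub>R y"
proof -
  have *: "L q z = (L q z \<bullet> x) *\<^sub>R x + (L q z \<bullet> y) *\<^sub>R y" for z
    using frame_expansion[OF N_unit[OF q(2)] x(1) y(1) xy x(2) y(2)] L_tangent[OF q(1)] R_id[OF q] by simp
  show "L q x = (L q x \<bullet> x) *\<^sub>R x + (L q x \<bullet> y) *\<^sub>R y" by (rule *)
  show "L q y = (L q x \<bullet> y) *\<^sub>R x + (L q y \<bullet> y) *\<^sub>R y"
    using *[of y] L_symmetric[OF q x(2) y(2)] by simp
qed

text \<open>The vector \<open>v + r L q v\<close> is the velocity \<open>\<gamma>' + r (N \<circ> \<gamma>)'\<close> of the centre when the ball leaves \<open>q\<close> in the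
direction \<open>v\<close>. The expression is written in terms of the entries \<open>- L q x \<bullet> x\<close>, ... of the shape operator.\<close>

lemma centre_velocity_norm:
  fixes r s t :: real
  defines "v \<equiv> s *\<^sub>R x + t *\<^sub>R y"
  shows "(norm (v + r *\<^sub>R L q v))\<^sup>2
    = (s * (1 - r * - (L q x \<bullet> x)) - t * (r * - (L q x \<bullet> y)))\<^sup>2
      + (t * (1 - r * - (L q y \<bullet> y)) - s * (r * - (L q x \<bullet> y)))\<^sup>2"
proof -
  have o: "x \<bullet> x = 1" "y \<bullet> y = 1" "y \<bullet> x = 0" using x y xy by (simp_all add: dot_square_norm inner_commute)
  define a b c where "a = L q x \<bullet> x" and "b = L q x \<bullet> y" and "c = L q y \<bullet> y"
  have "v + r *\<^sub>R L q v = v + r *\<^sub>R (s *\<^sub>R L q x + t *\<^sub>R L q y)"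
    by (simp add: v_def blinfun.add_right blinfun.scaleR_right)
  also have "\<dots> = (s + r * (s * a + t * b)) *\<^sub>R x + (t + r * (s * b + t * c)) *\<^sub>R y"
    unfolding v_def by (subst L_frame(1), subst L_frame(2)) (simp add: a_def b_def c_def algebra_simps)
  finally have "(norm (v + r *\<^sub>R L q v))\<^sup>2 = (s + r * (s * a + t * b))\<^sup>2 + (t + r * (s * b + t * c))\<^sup>2"
    unfolding power2_norm_eq_inner by (simp add: inner_add_left inner_add_right o xy power2_eq_square)
  then show ?thesis by (simp add: a_def b_def c_def algebra_simps)
qed

lemma constant_centre_speed_imp:
  assumes r: "r \<noteq> 0" and "\<not> umbilic S N q"
    and const: "\<And>v. N q \<bullet> v = 0 \<Longrightarrow> norm v = 1 \<Longrightarrow> norm (v + r *\<^sub>R L q v) = \<sigma>"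
  shows "r * mean_curvature S N q = 1"
proof -
  have "r * (- (L q x \<bullet> x) + - (L q y \<bullet> y)) = 2"
  proof (rule equal_lengths_imp[OF r])
    show "\<not> (- (L q x \<bullet> x) = - (L q y \<bullet> y) \<and> - (L q x \<bullet> y) = 0)"
      using assms(2) umbilic_frame by auto
    fix s t :: real assume "s\<^sup>2 + t\<^sup>2 = 1"
    then have "N q \<bullet> (s *\<^sub>R x + t *\<^sub>R y) = 0 \<and> norm (s *\<^sub>R x + t *\<^sub>R y) = 1"
      unfolding unit_tangent_iff by blast
    then show "(s * (1 - r * - (L q x \<bullet> x)) - t * (r * - (L q x \<bullet> y)))\<^sup>2
      + (t * (1 - r * - (L q y \<bullet> y)) - s * (r * - (L q x \<bullet> y)))\<^sup>2 = \<sigma>\<^sup>2"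
      using const centre_velocity_norm by metis
  qed
  then show ?thesis unfolding mean_curvature_frame by (simp add: algebra_simps)
qed

text \<open>If \<open>r H = 1\<close>, the matrix of \<open>I - r W\<close> is symmetric with trace 0, so it is a reflection times the scalar
\<open>\<sigma>\<close>. The scalar vanishes only if \<open>W\<close> is a multiple of the identity.\<close>

lemma constant_centre_speed:
  assumes "\<not> umbilic S N q" "r * mean_curvature S N q = 1"
  shows "\<exists>\<sigma>>0. \<forall>v. N q \<bullet> v = 0 \<and> norm v = 1 \<longrightarrow> norm (v + r *\<^sub>R L q v) = \<sigma>"
proof -
  define k where "k = 1 + r * (L q x \<bullet> x)"
  define m where "m = r * (L q x \<bullet> y)"
  have r: "r \<noteq> 0" using assms(2) by auto
  have c: "1 + r * (L q y \<bullet> y) = - k"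
    using assms(2) unfolding mean_curvature_frame k_def by (simp add: field_simps)
  \<comment> \<open>the square of \<open>\<sigma>\<close>\<close>
  have nz: "k\<^sup>2 + m\<^sup>2 \<noteq> 0"
  proof
    assume "k\<^sup>2 + m\<^sup>2 = 0"
    then have "k = 0" "m = 0" by (simp_all only: sum_power2_eq_zero_iff)
    then have "r * (L q x \<bullet> x) = r * (L q y \<bullet> y)" using c unfolding k_def by linarith
    moreover have "L q x \<bullet> y = 0" using \<open>m = 0\<close> r by (simp add: m_def)
    ultimately show False using assms(1) r umbilic_frame by simp
  qed
  have "norm (v + r *\<^sub>R L q v) = sqrt (k\<^sup>2 + m\<^sup>2)" if "N q \<bullet> v = 0" "norm v = 1" for v
  proof -
    have "\<exists>s t. v = s *\<^sub>R x + t *\<^sub>R y \<and> s\<^sup>2 + t\<^sup>2 = 1" using that by (simp only: unit_tangent_iff[symmetric])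
    then obtain s t where v: "v = s *\<^sub>R x + t *\<^sub>R y" and st: "s\<^sup>2 + t\<^sup>2 = 1" by blast
    have "(norm (v + r *\<^sub>R L q v))\<^sup>2 = (s * k + t * m)\<^sup>2 + (t * (- k) + s * m)\<^sup>2"
      unfolding v centre_velocity_norm c[symmetric] by (simp add: k_def m_def)
    also have "\<dots> = (k\<^sup>2 + m\<^sup>2) * (s\<^sup>2 + t\<^sup>2)" by (simp add: power2_eq_square algebra_simps)
    finally show ?thesis using st by (metis mult.right_neutral norm_ge_zero real_sqrt_unique)
  qed
  moreover have "sqrt (k\<^sup>2 + m\<^sup>2) > 0" using nz by (simp add: sum_power2_gt_zero_iff sum_power2_eq_zero_iff del: real_sqrt_sum_squares_eq_cancel)
  ultimately show ?thesis by blast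
qed

end

end

section \<open>Rolling\<close>

lemma isom_image_sphere:
  assumes "orthogonal_matrix (A t)"
  shows "isom A b t ` sphere c \<rho> = sphere (isom A b t c) \<rho>"
proof -
  have orth: "A t ** transpose (A t) = mat 1"
    using assms by (simp add: orthogonal_matrix_def)
  have dist: "dist (isom A b t x) (isom A b t y) = dist x y" for x y
  proof -
    have "orthogonal_transformation ((*v) (A t))"
      using assms by (simp add: orthogonal_transformation_matrix matrix_of_matrix_vector_mul)
    then have "norm (A t *v (x - y)) = norm (x - y)" by (rule orthogonal_transformation_norm)
    then show ?thesis by (simp add: isom_def dist_norm matrix_vector_mult_diff_distrib)
  qed
  show ?thesis
  proof
    show "isom A b t ` sphere c \<rho> \<subseteq> sphere (isom A b t c) \<rho>" using dist by auto
    show "sphere (isom A b t c) \<rho> \<subseteq> isom A b t ` sphere c \<rho>"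
    proof
      fix z assume z: "z \<in> sphere (isom A b t c) \<rho>"
      define x where "x = transpose (A t) *v (z - b t)"
      have "isom A b t x = z"
        by (simp add: isom_def x_def matrix_vector_mul_assoc orth del: transpose_matrix_vector)
      then show "z \<in> isom A b t ` sphere c \<rho>" using z dist[of c x] by (intro image_eqI[of _ _ x]) auto
    qed
  qed
qed

lemma tangent_space_sphere_subset:
  assumes "M \<subseteq> sphere c \<rho>" "v \<in> tangent_space M q"
  shows "(q - c) \<bullet> v = 0"
proof -
  obtain e \<alpha> where e: "e > 0" "\<alpha> ` {-e<..<e} \<subseteq> M" "\<alpha> 0 = q" "(\<alpha> has_vector_derivative v) (at 0)"
    using assms(2) unfolding tangent_space_def by blast
  have d: "((\<lambda>t. \<alpha> t - c) has_derivative (\<lambda>h. h *\<^sub>R v)) (at 0)"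
    using e(4) unfolding has_vector_derivative_def by (auto intro!: derivative_eq_intros)
  have "((\<lambda>t. (\<alpha> t - c) \<bullet> (\<alpha> t - c)) has_derivative
      (\<lambda>h. (\<alpha> 0 - c) \<bullet> (h *\<^sub>R v) + (h *\<^sub>R v) \<bullet> (\<alpha> 0 - c))) (at 0)"
    by (rule has_derivative_inner[OF d d])
  moreover have "((\<lambda>t. (\<alpha> t - c) \<bullet> (\<alpha> t - c)) has_derivative (\<lambda>h. 0)) (at 0)"
  proof (rule has_derivative_transform_within_open)
    show "((\<lambda>t. \<rho>\<^sup>2) has_derivative (\<lambda>h. 0)) (at (0::real))" by simp
    show "\<rho>\<^sup>2 = (\<alpha> t - c) \<bullet> (\<alpha> t - c)" if "t \<in> {-e<..<e}" for t
    proof -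
      have "\<alpha> t \<in> sphere c \<rho>" using e(2) assms(1) that by blast
      then show ?thesis by (simp add: dist_norm norm_minus_commute flip: power2_norm_eq_inner)
    qed
  qed (use e in auto)
  ultimately have "(\<lambda>h. (\<alpha> 0 - c) \<bullet> (h *\<^sub>R v) + (h *\<^sub>R v) \<bullet> (\<alpha> 0 - c)) = (\<lambda>h. 0)"
    by (rule has_derivative_unique)
  from fun_cong[OF this, of 1] show ?thesis using e(3) by (simp add: inner_commute)
qed

text \<open>A vector \<open>v\<close> orthogonal to \<open>q - c\<close> is the velocity of the line \<open>q + t v\<close> projected radially to the
sphere.\<close>

lemma tangent_space_sphere:
  assumes q: "q \<in> sphere c \<rho>" and \<rho>: "\<rho> > 0"
  shows "tangent_space (sphere c \<rho>) q = {v. (q - c) \<bullet> v = 0}"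
proof
  show "tangent_space (sphere c \<rho>) q \<subseteq> {v. (q - c) \<bullet> v = 0}"
    using tangent_space_sphere_subset by blast
  show "{v. (q - c) \<bullet> v = 0} \<subseteq> tangent_space (sphere c \<rho>) q"
  proof
    fix v assume "v \<in> {v. (q - c) \<bullet> v = 0}"
    then have v: "(q - c) \<bullet> v = 0" by simp
    have n: "norm (q - c) = \<rho>" using q by (simp add: dist_norm norm_minus_commute)
    define w where "w t = (q - c) + t *\<^sub>R v" for t :: real
    have nz: "w t \<noteq> 0" for t
    proof
      assume "w t = 0"
      then have "(q - c) \<bullet> w t = 0" by simp
      then have "(norm (q - c))\<^sup>2 = 0" using v by (simp add: w_def inner_add_right power2_norm_eq_inner)
      then show False using n \<rho> by simp
    qed
    define \<alpha> where "\<alpha> t = c + \<rho> *\<^sub>R (w t /\<^sub>R norm (w t))" for t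
    define \<alpha>' where "\<alpha>' t = \<rho> *\<^sub>R (v /\<^sub>R norm (w t) - (w t \<bullet> v / norm (w t) ^ 3) *\<^sub>R w t)" for t
    have dw: "(w has_derivative (\<lambda>h. h *\<^sub>R v)) (at t)" for t
      unfolding w_def[abs_def] by (auto intro!: derivative_eq_intros)
    have d: "(\<alpha> has_vector_derivative \<alpha>' t) (at t)" for t
    proof -
      have "((\<lambda>t. c + \<rho> *\<^sub>R (w t /\<^sub>R norm (w t))) has_derivative (\<lambda>h. 0 + \<rho> *\<^sub>R ((h *\<^sub>R v) /\<^sub>R norm (w t)
        - (w t \<bullet> (h *\<^sub>R v) / norm (w t) ^ 3) *\<^sub>R w t))) (at t)"
        by (intro has_derivative_add has_derivative_const has_derivative_scaleR_right has_derivative_normalize dw nz)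
      moreover have "(\<lambda>h. 0 + \<rho> *\<^sub>R ((h *\<^sub>R v) /\<^sub>R norm (w t) - (w t \<bullet> (h *\<^sub>R v) / norm (w t) ^ 3) *\<^sub>R w t))
          = (\<lambda>h. h *\<^sub>R \<alpha>' t)"
        by (simp add: \<alpha>'_def fun_eq_iff scaleR_diff_right scaleR_left_commute mult.left_commute)
      ultimately show ?thesis unfolding has_vector_derivative_def \<alpha>_def[abs_def] by simp
    qed
    have "continuous_on {-1<..<1} \<alpha>'"
      unfolding \<alpha>'_def[abs_def] using nz by (intro continuous_intros) (auto simp: w_def intro!: continuous_intros)
    then have "\<alpha> C1_differentiable_on {-1<..<1}"
      unfolding C1_differentiable_on_def using d by blast
    moreover have "\<alpha> ` {-1<..<1} \<subseteq> sphere c \<rho>" using nz \<rho> by (auto simp: \<alpha>_def dist_norm)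
    moreover have "\<alpha> 0 = q" using n \<rho> by (simp add: \<alpha>_def w_def)
    moreover have "\<alpha>' 0 = v" using n \<rho> v by (simp add: \<alpha>'_def w_def)
    ultimately show "v \<in> tangent_space (sphere c \<rho>) q"
      unfolding tangent_space_def using d[of 0]
      by (intro CollectI exI[of _ 1] conjI exI[of _ \<alpha>]) auto
  qed
qed

lemma bounded_bilinear_matrix_mult: "bounded_bilinear ((**) :: real^3^3 \<Rightarrow> real^3^3 \<Rightarrow> real^3^3)"
proof -
  have "bilinear ((**) :: real^3^3 \<Rightarrow> real^3^3 \<Rightarrow> real^3^3)"
    unfolding bilinear_def
    by (intro conjI allI linearI)
      (simp_all add: matrix_matrix_mult_def vec_eq_iff sum.distrib sum_distrib_left algebra_simps)
  then show ?thesis using bilinear_conv_bounded_bilinear by blast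
qed

text \<open>Lengths \<open>\<bar>A t x\<bar>\<close> are constant because the velocity \<open>\<omega> \<times> A t x\<close> is orthogonal to \<open>A t x\<close>; the
determinant stays at its initial value 1 by continuity.\<close>

lemma skew_flow_rotation:
  fixes A :: "real \<Rightarrow> real^3^3" and \<omega> :: "real \<Rightarrow> real^3"
  assumes dA: "\<And>t. t \<in> {0..\<epsilon>} \<Longrightarrow> (A has_vector_derivative matrix (cross3 (\<omega> t)) ** A t) (at t within {0..\<epsilon>})"
    and A0: "A 0 = mat 1" and t: "t \<in> {0..\<epsilon>}"
  shows "rotation_matrix (A t)"
proof -
  have orth: "orthogonal_matrix (A s)" if s: "s \<in> {0..\<epsilon>}" for s
  proof -
    have "norm (A s *v x) = norm x" for x
    proof -
      have d: "((\<lambda>t. A t *v x) has_derivative (\<lambda>h. h *\<^sub>R cross3 (\<omega> t) (A t *v x))) (at t within {0..\<epsilon>})"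
        if "t \<in> {0..\<epsilon>}" for t
        using bounded_linear.has_vector_derivative[OF bounded_linear_matrix_vector_left dA[OF that], of x]
        by (simp add: has_vector_derivative_def matrix_vector_mul_assoc[symmetric] matrix_cross)
      have z: "((\<lambda>t. (A t *v x) \<bullet> (A t *v x)) has_derivative (\<lambda>h. 0)) (at t within {0..\<epsilon>})"
        if "t \<in> {0..\<epsilon>}" for t
        using has_derivative_inner[OF d[OF that] d[OF that]]
        by (simp add: inner_commute dot_cross_self)
      have "\<exists>k. \<forall>t\<in>{0..\<epsilon>}. (A t *v x) \<bullet> (A t *v x) = k"
        by (rule has_derivative_zero_constant[OF convex_real_interval(5) z])
      then obtain k where k: "\<And>t. t \<in> {0..\<epsilon>} \<Longrightarrow> (A t *v x) \<bullet> (A t *v x) = k" by blast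
      have "0 \<in> {0..\<epsilon>}" using s by simp
      then have "(A s *v x) \<bullet> (A s *v x) = (A 0 *v x) \<bullet> (A 0 *v x)" using k[OF s] k[of 0] by simp
      then show ?thesis using A0 by (simp add: norm_eq)
    qed
    then have "orthogonal_transformation ((*v) (A s))"
      by (simp add: orthogonal_transformation)
    then show ?thesis by (simp add: orthogonal_transformation_matrix matrix_of_matrix_vector_mul)
  qed
  have "continuous_on {0..\<epsilon>} A" by (rule continuous_on_vector_derivative[OF dA])
  then have "continuous_on {0..\<epsilon>} (\<lambda>s. A s $ i $ j)" for i j
    by (intro continuous_on_component)
  then have "continuous_on {0..\<epsilon>} (\<lambda>s. det (A s))"
    unfolding det_3 by (intro continuous_on_add continuous_on_diff continuous_on_mult)
  moreover have "(\<lambda>s. det (A s)) ` {0..\<epsilon>} \<subseteq> {1, -1}" using det_orthogonal_matrix orth by blast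
  then have "finite ((\<lambda>s. det (A s)) ` {0..\<epsilon>})" using finite_subset by blast
  ultimately have "(\<lambda>s. det (A s)) constant_on {0..\<epsilon>}"
    by (intro continuous_finite_range_constant) auto
  then have "det (A t) = det (A 0)" using t unfolding constant_on_def by force
  then show ?thesis using orth[OF t] A0 by (simp add: rotation_matrix_def det_I)
qed

lemma angular_velocity_eqI:
  assumes "spin_matrix l A t = matrix (cross3 w)"
  shows "angular_velocity l A t = w"
proof -
  have spin: "spin_matrix l A t *v x = cross3 w x" for x
    using assms matrix_cross by simp
  have "w' = w" if "\<forall>x. spin_matrix l A t *v x = cross3 w' x" for w'
  proof -
    have 0: "cross3 (w' - w) x = 0" for x using that spin by (simp add: Cross3.left_diff_distrib)
    obtain y where y: "y \<noteq> 0" "orthogonal (w' - w) y" using orthogonal_to_vector_exists[of "w' - w"] by auto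
    then have "w' - w = 0" using norm_and_cross_eq_0[of "w' - w" y] 0[of y] by (simp add: orthogonal_def)
    then show ?thesis by simp
  qed
  with spin show ?thesis unfolding angular_velocity_def by (intro the_equality) auto
qed

context surface_patch begin

text \<open>Tangency at \<open>\<gamma> t\<close> puts the centre at \<open>\<gamma> t + r N\<close> or \<open>\<gamma> t - r N\<close>, and continuity selects the side on which it
starts; it remains to differentiate \<open>\<gamma> + r (N \<circ> \<gamma>)\<close>.\<close>

lemma rolling_speed:
  assumes r: "r \<noteq> 0" and \<gamma>: "unit_speed_curve S l \<gamma>" "\<gamma> 0 = q" "q \<in> V" and \<epsilon>: "0 < \<epsilon>" "\<epsilon> \<le> l"
    and roll: "rolling S N r \<gamma> \<epsilon> A b"
  shows "ball_speed N q r \<epsilon> A b 0 = norm (time_deriv l \<gamma> 0 + r *\<^sub>R L q (time_deriv l \<gamma> 0))"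
proof -
  define C where "C t = isom A b t (ball_center N q r)" for t
  have sub: "\<gamma> ` {0..\<epsilon>} \<subseteq> S" and C1: "C1_upto l \<gamma>"
    using \<gamma>(1) \<epsilon> by (auto simp: unit_speed_curve_def C2_upto_def)
  have motion: "C1_upto \<epsilon> A" "C1_upto \<epsilon> b" "\<And>t. t \<in> {0..\<epsilon>} \<Longrightarrow> rotation_matrix (A t)" "isom A b 0 = id"
    "\<And>t. t \<in> {0..\<epsilon>} \<Longrightarrow> tangent_at (isom A b t ` sphere (ball_center N q r) \<bar>r\<bar>) S (\<gamma> t)"
    using roll \<gamma>(2) unfolding rolling_def motion_along_def ball_surface_def by auto
  define k where "k t = (C t - \<gamma> t) \<bullet> N (\<gamma> t)" for t
  have key: "C t - \<gamma> t = k t *\<^sub>R N (\<gamma> t) \<and> (k t)\<^sup>2 = r\<^sup>2" if t: "t \<in> {0..\<epsilon>}" for t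
  proof -
    have q: "\<gamma> t \<in> S" using sub t by auto
    have "isom A b t ` sphere (ball_center N q r) \<bar>r\<bar> = sphere (C t) \<bar>r\<bar>"
      unfolding C_def using motion(3)[OF t] by (intro isom_image_sphere) (simp add: rotation_matrix_def)
    then have tan: "tangent_at (sphere (C t) \<bar>r\<bar>) S (\<gamma> t)" using motion(5)[OF t] by simp
    then have perp: "(\<gamma> t - C t) \<bullet> v = 0" if "N (\<gamma> t) \<bullet> v = 0" for v
      using tangent_space_sphere_subset[OF order_refl] tangent_space_eq[OF q] that
      unfolding tangent_at_def by blast
    \<comment> \<open>the tangential part of \<open>C t - \<gamma> t\<close>, which vanishes as the radius is orthogonal to the tangent plane\<close>
    define w where "w = C t - \<gamma> t - k t *\<^sub>R N (\<gamma> t)"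
    have NN: "N (\<gamma> t) \<bullet> N (\<gamma> t) = 1" using N_unit[OF q] by (simp add: dot_square_norm)
    have Nw: "N (\<gamma> t) \<bullet> w = 0"
      by (simp add: w_def k_def inner_diff_right inner_diff_left NN inner_commute)
    have "w \<bullet> w = - ((\<gamma> t - C t) \<bullet> w) - k t * (N (\<gamma> t) \<bullet> w)"
      by (simp add: w_def inner_diff_left inner_diff_right algebra_simps)
    then have "w = 0" using perp[OF Nw] Nw by simp
    then have eq: "C t - \<gamma> t = k t *\<^sub>R N (\<gamma> t)" by (simp add: w_def)
    have "norm (C t - \<gamma> t) = \<bar>r\<bar>" using tan by (simp add: tangent_at_def dist_norm)
    then have "\<bar>k t\<bar> = \<bar>r\<bar>" unfolding eq using N_unit[OF q] by simp
    then show ?thesis using eq by (metis power2_abs)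
  qed
  have cC: "continuous_on {0..\<epsilon>} C"
    unfolding C_def isom_def
    by (intro continuous_intros bounded_linear.continuous_on[OF bounded_linear_matrix_vector_left] C1_upto_continuous motion)
  have "continuous_on {0..l} \<gamma>" using C1 by (rule C1_upto_continuous)
  then have c\<gamma>: "continuous_on {0..\<epsilon>} \<gamma>" by (rule continuous_on_subset) (use \<epsilon> in auto)
  have "continuous_on {0..\<epsilon>} (\<lambda>t. N (\<gamma> t))" by (rule continuous_on_compose2[OF cont_N c\<gamma> sub])
  then have "continuous_on {0..\<epsilon>} k" unfolding k_def by (intro continuous_intros cC c\<gamma>)
  moreover have "k ` {0..\<epsilon>} \<subseteq> {r, -r}" using key power2_eq_iff by blast
  then have "finite (k ` {0..\<epsilon>})" using finite_subset by blast
  ultimately have "k constant_on {0..\<epsilon>}" by (intro continuous_finite_range_constant) auto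
  then have k_const: "k t = k 0" if "t \<in> {0..\<epsilon>}" for t using that \<epsilon> unfolding constant_on_def by force
  have "k 0 = r"
  proof -
    have "q \<in> S" using sub \<gamma>(2) \<epsilon>(1) by force
    then have "N q \<bullet> N q = 1" using N_unit by (simp add: dot_square_norm)
    then show ?thesis using motion(4) \<gamma>(2) by (simp add: k_def C_def ball_center_def)
  qed
  then have C_eq: "C t = \<gamma> t + r *\<^sub>R N (\<gamma> t)" if "t \<in> {0..\<epsilon>}" for t
    using key[OF that] k_const[OF that] by (simp add: algebra_simps)
  obtain \<eta> where \<eta>: "0 < \<eta>" "\<eta> \<le> \<epsilon>" "\<gamma> ` {0..\<eta>} \<subseteq> S \<inter> V"
  proof -
    obtain \<eta> where "0 < \<eta>" "\<eta> \<le> l" "\<gamma> ` {0..\<eta>} \<subseteq> S \<inter> V" using short_arc[OF \<gamma>(1)] \<gamma>(2,3) by blast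
    then show thesis using \<epsilon>(1) by (intro that[of "min \<eta> \<epsilon>"]) auto
  qed
  have 0: "0 \<in> {0..\<eta>}" "0 \<in> {0..\<epsilon>}" "0 \<in> {0..l}" using \<eta>(1) \<epsilon> by auto
  define v where "v = time_deriv l \<gamma> 0"
  have d\<gamma>: "(\<gamma> has_vector_derivative v) (at 0 within {0..\<eta>})"
    unfolding v_def by (rule has_vector_derivative_within_subset[OF C1_uptoD[OF C1 0(3)]]) (use \<eta> \<epsilon> in auto)
  have "((\<lambda>t. \<gamma> t + r *\<^sub>R N (\<gamma> t)) has_vector_derivative v + r *\<^sub>R L q v) (at 0 within {0..\<eta>})"
    using has_vector_derivative_add[OF d\<gamma> bounded_linear.has_vector_derivative[OF bounded_linear_scaleR_right
        normal_along_curve[OF \<eta>(3) 0(1) d\<gamma>], of r]] \<gamma>(2) by simp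
  then have 1: "(C has_vector_derivative v + r *\<^sub>R L q v) (at 0 within {0..\<eta>})"
    by (rule has_vector_derivative_transform[OF 0(1), rotated]) (use C_eq \<eta>(2) in auto)
  have dA: "(A has_vector_derivative time_deriv \<epsilon> A 0) (at 0 within {0..\<epsilon>})"
    and db: "(b has_vector_derivative time_deriv \<epsilon> b 0) (at 0 within {0..\<epsilon>})"
    using C1_uptoD motion(1,2) 0(2) by blast+
  have 2: "(C has_vector_derivative time_deriv \<epsilon> A 0 *v ball_center N q r + time_deriv \<epsilon> b 0) (at 0 within {0..\<epsilon>})"
    unfolding C_def[abs_def] isom_def
    by (rule has_vector_derivative_add[OF bounded_linear.has_vector_derivative[OF bounded_linear_matrix_vector_left dA] db])
  then have "(C has_vector_derivative time_deriv \<epsilon> A 0 *v ball_center N q r + time_deriv \<epsilon> b 0) (at 0 within {0..\<eta>})"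
    by (rule has_vector_derivative_within_subset) (use \<eta> in auto)
  from time_deriv_eq[OF this 0(1) \<eta>(1)] time_deriv_eq[OF 1 0(1) \<eta>(1)] time_deriv_eq[OF 2 0(2) \<epsilon>(1)]
  show ?thesis unfolding ball_speed_def C_def[symmetric] v_def by simp
qed
text \<open>The motion is recovered from the path \<open>C = \<gamma> + r (N \<circ> \<gamma>)\<close> of the centre. The contact point is at rest
when \<open>C' = \<omega> \<times> (C - \<gamma>) = r \<omega> \<times> N\<close>, and the solution of this equation that is tangent to \<open>S\<close> is
\<open>\<omega> = N \<times> C' / r\<close>. The rotations \<open>A\<close> then solve \<open>A' = \<omega> \<times> A\<close>, and the translations are determined by the
condition that the centre moves along \<open>C\<close>. The assumption on the initial velocity of the centre makes
\<open>\<omega> \<noteq> 0\<close> for a short time, as a rotational motion requires.\<close>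

lemma rolling_exists:
  assumes r: "r \<noteq> 0" and \<gamma>: "unit_speed_curve S l \<gamma>" "\<gamma> 0 = q" "q \<in> V"
    and nz: "time_deriv l \<gamma> 0 + r *\<^sub>R L q (time_deriv l \<gamma> 0) \<noteq> 0"
  shows "\<exists>\<epsilon> A b. 0 < \<epsilon> \<and> \<epsilon> \<le> l \<and> rolling S N r \<gamma> \<epsilon> A b"
proof -
  have C1: "C1_upto l \<gamma>" using \<gamma>(1) by (auto simp: unit_speed_curve_def C2_upto_def)
  obtain \<epsilon>1 where \<epsilon>1: "0 < \<epsilon>1" "\<epsilon>1 \<le> l" "\<gamma> ` {0..\<epsilon>1} \<subseteq> S \<inter> V" using short_arc[OF \<gamma>(1)] \<gamma>(2,3) by blast
  define g where "g = time_deriv l \<gamma>"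
  have dg1: "(\<gamma> has_vector_derivative g t) (at t within {0..\<epsilon>1})" if "t \<in> {0..\<epsilon>1}" for t
    unfolding g_def by (rule has_vector_derivative_within_subset[OF C1_uptoD[OF C1]]) (use that \<epsilon>1 in auto)
  \<comment> \<open>the velocity of the centre\<close>
  define y where "y t = g t + r *\<^sub>R L (\<gamma> t) (g t)" for t
  have "continuous_on {0..l} g" using C1 by (simp add: C1_upto_def g_def)
  then have cg1: "continuous_on {0..\<epsilon>1} g" by (rule continuous_on_subset) (use \<epsilon>1 in auto)
  have c\<gamma>1: "continuous_on {0..\<epsilon>1} \<gamma>"
    using C1_upto_continuous[OF C1] by (rule continuous_on_subset) (use \<epsilon>1 in auto)
  have cL1: "continuous_on {0..\<epsilon>1} (\<lambda>t. L (\<gamma> t))"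
    by (rule continuous_on_compose2[OF cont_L c\<gamma>1]) (use \<epsilon>1(3) in auto)
  have cy1: "continuous_on {0..\<epsilon>1} y" unfolding y_def by (intro continuous_intros cg1 cL1)
  have cN1: "continuous_on {0..\<epsilon>1} (\<lambda>t. N (\<gamma> t))"
    by (rule continuous_on_compose2[OF cont_N c\<gamma>1]) (use \<epsilon>1(3) in auto)
  have "y 0 \<noteq> 0" using nz \<gamma>(2) by (simp add: y_def g_def)
  then obtain d where d: "d > 0" "\<And>t. t \<in> {0..\<epsilon>1} \<Longrightarrow> dist t 0 < d \<Longrightarrow> dist (y t) (y 0) < norm (y 0)"
    using cy1 \<epsilon>1(1) unfolding continuous_on_iff by (metis atLeastAtMost_iff less_eq_real_def zero_less_norm_iff)
  define \<epsilon>2 where "\<epsilon>2 = min \<epsilon>1 (d / 2)"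
  have \<epsilon>2: "0 < \<epsilon>2" "\<epsilon>2 \<le> \<epsilon>1" "\<epsilon>2 < d" using d(1) \<epsilon>1(1) by (auto simp: \<epsilon>2_def)
  have y_nz: "y t \<noteq> 0" if "t \<in> {0..\<epsilon>2}" for t
    using d(2)[of t] that \<epsilon>2 by (auto simp: dist_real_def dist_norm)
  define \<omega> where "\<omega> t = (1 / r) *\<^sub>R cross3 (N (\<gamma> t)) (y t)" for t
  have sub12: "{0..\<epsilon>2} \<subseteq> {0..\<epsilon>1}" using \<epsilon>2 by auto
  have c\<omega>: "continuous_on {0..\<epsilon>2} \<omega>"
    unfolding \<omega>_def
    by (intro continuous_intros continuous_on_cross continuous_on_subset[OF cN1 sub12] continuous_on_subset[OF cy1 sub12])
  define Q where "Q t = matrix (cross3 (\<omega> t))" for t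
  have cQ: "continuous_on {0..\<epsilon>2} Q"
    unfolding Q_def matrix_def
    by (intro continuous_on_vec_lambda continuous_intros continuous_on_cross c\<omega>)
  obtain \<epsilon> A where \<epsilon>': "0 < \<epsilon>" "\<epsilon> \<le> \<epsilon>2" and A0: "A 0 = (mat 1 :: real^3^3)" and cA: "continuous_on {0..\<epsilon>} A"
    and dA: "\<And>t. t \<in> {0..\<epsilon>} \<Longrightarrow> (A has_vector_derivative Q t ** A t) (at t within {0..\<epsilon>})"
    using linear_ODE_short_time[OF bounded_bilinear_matrix_mult \<epsilon>2(1) cQ, of "mat 1"] by metis
  have sub: "{0..\<epsilon>} \<subseteq> {0..\<epsilon>2}" "{0..\<epsilon>} \<subseteq> {0..\<epsilon>1}" "{0..\<epsilon>} \<subseteq> {0..l}" using \<epsilon>' \<epsilon>2 \<epsilon>1 by auto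
  have arc: "\<gamma> ` {0..\<epsilon>} \<subseteq> S \<inter> V" using \<epsilon>1(3) sub(2) by blast
  have rot: "rotation_matrix (A t)" if "t \<in> {0..\<epsilon>}" for t
    by (rule skew_flow_rotation[OF dA[unfolded Q_def] A0 that])
  have AAT: "A t ** transpose (A t) = mat 1" if "t \<in> {0..\<epsilon>}" for t
    using rot[OF that] by (simp add: rotation_matrix_def orthogonal_matrix_def)
  define C where "C t = \<gamma> t + r *\<^sub>R N (\<gamma> t)" for t
  have dg: "(\<gamma> has_vector_derivative g t) (at t within {0..\<epsilon>})" if "t \<in> {0..\<epsilon>}" for t
    using has_vector_derivative_within_subset[OF dg1 sub(2)] that sub by blast
  have dC: "(C has_vector_derivative y t) (at t within {0..\<epsilon>})" if "t \<in> {0..\<epsilon>}" for t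
    unfolding C_def[abs_def] y_def
    by (intro has_vector_derivative_add dg that bounded_linear.has_vector_derivative[OF bounded_linear_scaleR_right]
        normal_along_curve[OF arc])
  define b where "b t = C t - A t *v C 0" for t
  have db: "(b has_vector_derivative y t - (Q t ** A t) *v C 0) (at t within {0..\<epsilon>})" if "t \<in> {0..\<epsilon>}" for t
    unfolding b_def[abs_def]
    by (intro has_vector_derivative_diff dC that bounded_linear.has_vector_derivative[OF bounded_linear_matrix_vector_left] dA)
  have cQA: "continuous_on {0..\<epsilon>} (\<lambda>t. Q t ** A t)"
    by (intro bounded_bilinear.continuous_on[OF bounded_bilinear_matrix_mult] cA continuous_on_subset[OF cQ sub(1)])
  have C1A: "C1_upto \<epsilon> A" by (rule C1_uptoI[OF \<epsilon>'(1) dA cQA])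
  have C1b: "C1_upto \<epsilon> b"
    by (rule C1_uptoI[OF \<epsilon>'(1) db])
      (auto intro!: continuous_intros bounded_linear.continuous_on[OF bounded_linear_matrix_vector_left] cQA continuous_on_subset[OF cy1 sub(2)])
  have isom_C: "isom A b t (C 0) = C t" for t by (simp add: isom_def b_def)
  have C0: "C 0 = ball_center N (\<gamma> 0) r" by (simp add: C_def ball_center_def)
  have \<gamma>S: "\<gamma> t \<in> S" if "t \<in> {0..\<epsilon>}" for t using arc that by auto
  have tangent: "tangent_at (isom A b t ` ball_surface N (\<gamma> 0) r) S (\<gamma> t)" if t: "t \<in> {0..\<epsilon>}" for t
  proof -
    have "isom A b t ` ball_surface N (\<gamma> 0) r = sphere (C t) \<bar>r\<bar>"
      using isom_image_sphere[of A t b "C 0" "\<bar>r\<bar>"] rot[OF t]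
      by (simp add: ball_surface_def C0 isom_C rotation_matrix_def flip: C0)
    moreover have on: "\<gamma> t \<in> sphere (C t) \<bar>r\<bar>"
      using N_unit[OF \<gamma>S[OF t]] by (simp add: C_def dist_norm)
    moreover have "tangent_space (sphere (C t) \<bar>r\<bar>) (\<gamma> t) = tangent_space S (\<gamma> t)"
      using tangent_space_sphere[OF on] tangent_space_eq[OF \<gamma>S[OF t]] r by (simp add: C_def)
    ultimately show ?thesis using \<gamma>S[OF t] by (simp add: tangent_at_def)
  qed
  have id: "isom A b 0 = id" by (simp add: isom_def b_def A0 fun_eq_iff)
  have spin: "spin_matrix \<epsilon> A t = Q t" if t: "t \<in> {0..\<epsilon>}" for t
    using time_deriv_eq[OF dA[OF t] t \<epsilon>'(1)] AAT[OF t]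
    by (simp add: spin_matrix_def matrix_mul_assoc[symmetric])
  have Qv: "Q t *v x = cross3 (\<omega> t) x" for t x unfolding Q_def by (rule matrix_cross)
  have Ny: "N (\<gamma> t) \<bullet> y t = 0" if t: "t \<in> {0..\<epsilon>}" for t
  proof -
    have gt: "\<gamma> t \<in> V" "\<gamma> t \<in> S" using arc t by auto
    show ?thesis
      using velocity_tangent[OF \<epsilon>'(1) arc t dg[OF t]] L_tangent[OF gt(1), of "g t"] R_id[OF gt]
      by (simp add: y_def inner_add_right)
  qed
  have \<omega>N: "r *\<^sub>R cross3 (\<omega> t) (N (\<gamma> t)) = y t" if t: "t \<in> {0..\<epsilon>}" for t
  proof -
    have "cross3 (cross3 (N (\<gamma> t)) (y t)) (N (\<gamma> t)) = - cross3 (N (\<gamma> t)) (cross3 (N (\<gamma> t)) (y t))"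
      by (rule cross_skew)
    also have "\<dots> = y t"
      using Ny[OF t] N_unit[OF \<gamma>S[OF t]] by (simp add: Lagrange dot_square_norm)
    finally show ?thesis using r by (simp add: \<omega>_def cross_mult_left)
  qed
  have Q_nz: "Q t \<noteq> 0" if t: "t \<in> {0..\<epsilon>}" for t
  proof
    assume "Q t = 0"
    then have "cross3 (\<omega> t) (N (\<gamma> t)) = 0" using Qv[of t "N (\<gamma> t)"] by simp
    then show False using \<omega>N[OF t] y_nz[of t] t sub(1) by auto
  qed
  have fixed: "instantaneous_motion \<epsilon> A b t (\<gamma> t) = 0" if t: "t \<in> {0..\<epsilon>}" for t
  proof -
    have "instantaneous_motion \<epsilon> A b t (\<gamma> t) = Q t *v \<gamma> t + (y t - (Q t ** A t) *v C 0 - Q t *v b t)"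
      unfolding instantaneous_motion_def spin[OF t] time_deriv_eq[OF db[OF t] t \<epsilon>'(1)] ..
    also have "\<dots> = y t - Q t *v (C t - \<gamma> t)"
      by (simp add: b_def matrix_vector_mul_assoc matrix_vector_mult_diff_distrib)
    also have "\<dots> = y t - r *\<^sub>R cross3 (\<omega> t) (N (\<gamma> t))"
      by (simp add: C_def Qv cross_mult_right)
    finally show ?thesis using \<omega>N[OF t] by simp
  qed
  have angular: "angular_velocity \<epsilon> A t \<in> tangent_space S (\<gamma> t)" if t: "t \<in> {0..\<epsilon>}" for t
  proof -
    have "angular_velocity \<epsilon> A t = \<omega> t" by (rule angular_velocity_eqI) (simp add: spin[OF t] Q_def)
    moreover have "N (\<gamma> t) \<bullet> \<omega> t = 0" by (simp add: \<omega>_def dot_cross_self)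
    ultimately show ?thesis using tangent_space_eq[OF \<gamma>S[OF t]] by simp
  qed
  have "motion_along (ball_surface N (\<gamma> 0) r) S \<gamma> \<epsilon> A b"
    unfolding motion_along_def using C1A C1b rot id tangent by blast
  moreover have "rotational \<gamma> \<epsilon> A b"
    unfolding rotational_def
  proof (intro ballI conjI)
    fix t assume t: "t \<in> {0..\<epsilon>}"
    show "spin_matrix \<epsilon> A t \<noteq> 0" using Q_nz[OF t] spin[OF t] by simp
    show "instantaneous_motion \<epsilon> A b t (\<gamma> t) = 0" by (rule fixed[OF t])
  qed
  ultimately have "rolling S N r \<gamma> \<epsilon> A b"
    unfolding rolling_def using angular by blast
  moreover have "\<epsilon> \<le> l" using \<epsilon>' \<epsilon>2 \<epsilon>1 by linarith
  ultimately show ?thesis using \<epsilon>'(1) by blast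
qed

lemma rolls_isotropically_iff:
  assumes r: "r \<noteq> 0" and nonumb: "\<not> umbilic S N p"
  shows "rolls_isotropically S N r p \<longleftrightarrow> r * mean_curvature S N p = 1"
proof -
  obtain x y where fr: "norm x = 1" "norm y = 1" "x \<bullet> y = 0" "N p \<bullet> x = 0" "N p \<bullet> y = 0"
    using tangent_plane_frame[OF N_unit[OF p_S]] by metis
  note frame = p_V p_S fr(1,4,2,5,3)
  show ?thesis
  proof
    assume "rolls_isotropically S N r p"
    then obtain \<sigma> where \<sigma>: "\<forall>v\<in>tangent_space S p. norm v = 1 \<longrightarrow>
        (\<forall>l \<gamma>. unit_speed_curve S l \<gamma> \<and> \<gamma> 0 = p \<and> time_deriv l \<gamma> 0 = v \<longrightarrow>
           (\<exists>\<epsilon> A b. 0 < \<epsilon> \<and> \<epsilon> \<le> l \<and> rolling S N r \<gamma> \<epsilon> A b \<and> ball_speed N p r \<epsilon> A b 0 = \<sigma>))"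
      unfolding rolls_isotropically_def by (elim exE)
    show "r * mean_curvature S N p = 1"
    proof (rule constant_centre_speed_imp[OF frame r nonumb])
      fix v assume v: "N p \<bullet> v = 0" "norm v = 1"
      obtain l \<gamma> where \<gamma>: "unit_speed_curve S l \<gamma>" "\<gamma> 0 = p" "time_deriv l \<gamma> 0 = v"
        using unit_speed_exists[OF p_S v] by blast
      obtain \<epsilon> A b where "0 < \<epsilon>" "\<epsilon> \<le> l" "rolling S N r \<gamma> \<epsilon> A b" "ball_speed N p r \<epsilon> A b 0 = \<sigma>"
        using \<sigma>[rule_format, of v l \<gamma>] \<gamma> v tangent_space_eq[OF p_S] by auto
      then show "norm (v + r *\<^sub>R L p v) = \<sigma>"
        using rolling_speed[OF r \<gamma>(1,2) p_V] \<gamma>(3) by metis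
    qed
  next
    assume "r * mean_curvature S N p = 1"
    from constant_centre_speed[OF frame nonumb this]
    obtain \<sigma> where \<sigma>: "\<sigma> > 0" "\<And>v. N p \<bullet> v = 0 \<Longrightarrow> norm v = 1 \<Longrightarrow> norm (v + r *\<^sub>R L p v) = \<sigma>"
      by blast
    show "rolls_isotropically S N r p"
      unfolding rolls_isotropically_def
    proof (rule exI[of _ \<sigma>], intro ballI impI allI)
      fix v l \<gamma>
      assume v: "v \<in> tangent_space S p" "norm v = 1"
        and \<gamma>: "unit_speed_curve S l \<gamma> \<and> \<gamma> 0 = p \<and> time_deriv l \<gamma> 0 = v"
      have speed: "norm (v + r *\<^sub>R L p v) = \<sigma>" using \<sigma>(2) v tangent_space_eq[OF p_S] by blast
      then have "time_deriv l \<gamma> 0 + r *\<^sub>R L p (time_deriv l \<gamma> 0) \<noteq> 0" using \<sigma>(1) \<gamma> by auto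
      then obtain \<epsilon> A b where \<epsilon>: "0 < \<epsilon>" "\<epsilon> \<le> l" "rolling S N r \<gamma> \<epsilon> A b"
        using rolling_exists[OF r _ _ p_V] \<gamma> by blast
      moreover have "ball_speed N p r \<epsilon> A b 0 = \<sigma>"
        using rolling_speed[OF r _ _ p_V \<epsilon>] \<gamma> speed by blast
      ultimately show "\<exists>\<epsilon> A b. 0 < \<epsilon> \<and> \<epsilon> \<le> l \<and> rolling S N r \<gamma> \<epsilon> A b \<and> ball_speed N p r \<epsilon> A b 0 = \<sigma>"
        by blast
    qed
  qed
qed

end

section \<open>Surface pieces made of umbilics\<close>

text \<open>The gradient of \<open>h\<close> is \<open>K e\<close>, so \<open>h\<close> depends on \<open>q \<bullet> e\<close> only. Its derivative in the direction \<open>e\<close>, which is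
\<open>K\<close>, therefore also depends on \<open>q \<bullet> e\<close> only.\<close>

lemma slope_constant_across:
  fixes h K :: "'a::real_inner \<Rightarrow> real"
  assumes B: "open B" "convex B" and e: "norm e = 1"
    and dh: "\<And>q. q \<in> B \<Longrightarrow> (h has_derivative (\<lambda>z. K q * (z \<bullet> e))) (at q)"
    and q: "q \<in> B" "q' \<in> B" and perp: "(q' - q) \<bullet> e = 0"
  shows "K q = K q'"
proof -
  have line: "((\<lambda>s. h (a + s *\<^sub>R d)) has_real_derivative K (a + s *\<^sub>R d) * (d \<bullet> e)) (at s)"
    if "a + s *\<^sub>R d \<in> B" for a d s
  proof -
    have "((\<lambda>s. a + s *\<^sub>R d) has_derivative (\<lambda>k. k *\<^sub>R d)) (at s)"
      by (auto intro!: derivative_eq_intros)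
    from has_derivative_compose[OF this dh[OF that]]
    show ?thesis unfolding has_field_derivative_def
      by (rule has_derivative_eq_rhs) (auto simp: algebra_simps)
  qed
  have level: "h x = h y" if "x \<in> B" "y \<in> B" "(y - x) \<bullet> e = 0" for x y
  proof -
    have "\<exists>s>0. s < 1 \<and> h (x + 1 *\<^sub>R (y - x)) - h (x + 0 *\<^sub>R (y - x)) = (1 - 0) * (K (x + s *\<^sub>R (y - x)) * ((y - x) \<bullet> e))"
    proof (rule MVT2)
      fix s :: real assume s: "0 \<le> s" "s \<le> 1"
      have "x + s *\<^sub>R (y - x) = (1 - s) *\<^sub>R x + s *\<^sub>R y" by (simp add: algebra_simps)
      also have "\<dots> \<in> B" using B(2) that s by (intro convexD) auto
      finally show "((\<lambda>s. h (x + s *\<^sub>R (y - x))) has_real_derivative K (x + s *\<^sub>R (y - x)) * ((y - x) \<bullet> e)) (at s)"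
        by (rule line)
    qed simp
    then show ?thesis using that(3) by auto
  qed
  define T where "T = (\<lambda>s. q + s *\<^sub>R e) -` B \<inter> (\<lambda>s. q' + s *\<^sub>R e) -` B"
  have T: "open T" "0 \<in> T"
    using q unfolding T_def by (auto intro!: open_Int open_vimage B(1) continuous_intros)
  have "((\<lambda>s. h (q + s *\<^sub>R e)) has_derivative (*) (K q * (e \<bullet> e))) (at 0)"
    using line[of q 0 e] q(1) by (simp add: has_field_derivative_def)
  then have "((\<lambda>s. h (q' + s *\<^sub>R e)) has_derivative (*) (K q * (e \<bullet> e))) (at 0)"
  proof (rule has_derivative_transform_within_open[OF _ T])
    fix s assume "s \<in> T"
    then show "h (q + s *\<^sub>R e) = h (q' + s *\<^sub>R e)"
      using perp by (intro level) (auto simp: T_def)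
  qed
  moreover have "((\<lambda>s. h (q' + s *\<^sub>R e)) has_derivative (*) (K q' * (e \<bullet> e))) (at 0)"
    using line[of q' 0 e] q(2) by (simp add: has_field_derivative_def)
  ultimately have "(*) (K q * (e \<bullet> e)) = (*) (K q' * (e \<bullet> e))" by (rule has_derivative_unique)
  from fun_cong[OF this, of 1] show ?thesis using e by (simp add: dot_square_norm)
qed

context surface_patch begin

text \<open>Near \<open>p\<close> the tangent planes admit a continuous orthonormal frame, obtained by projecting a fixed tangent
vector at \<open>p\<close>; in such a frame \<open>H\<close> is half the trace of \<open>- L\<close>.\<close>

lemma continuous_mean_curvature: "continuous (at p within S) (mean_curvature S N)"
proof -
  obtain e y where e: "norm e = 1" "N p \<bullet> e = 0"
    using tangent_plane_frame[OF N_unit[OF p_S]] by metis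
  define w where "w q = e - (e \<bullet> N q) *\<^sub>R N q" for q
  define x where "x q = w q /\<^sub>R norm (w q)" for q
  define z where "z q = cross3 (N q) (x q)" for q
  have wp: "w p = e" using e by (simp add: w_def inner_commute)
  then have wp_nz: "w p \<noteq> 0" using e(1) by auto
  have N: "(N \<longlongrightarrow> N p) (at p within S)" using cont_N p_S by (simp add: continuous_on_def)
  then have w: "(w \<longlongrightarrow> w p) (at p within S)" unfolding w_def[abs_def] by (intro tendsto_intros)
  then have x: "(x \<longlongrightarrow> x p) (at p within S)"
    unfolding x_def[abs_def] using wp e by (intro tendsto_intros) auto
  have z: "(z \<longlongrightarrow> z p) (at p within S)"
    unfolding z_def[abs_def] by (intro bounded_bilinear.tendsto[OF bounded_bilinear_cross] N x)
  have "isCont L p" using cont_L open_V p_V by (simp add: continuous_on_eq_continuous_at)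
  then have L: "(L \<longlongrightarrow> L p) (at p within S)"
    unfolding isCont_def by (rule tendsto_within_subset) simp
  have lim: "((\<lambda>q. - (L q (x q) \<bullet> x q + L q (z q) \<bullet> z q) / 2) \<longlongrightarrow>
      - (L p (x p) \<bullet> x p + L p (z p) \<bullet> z p) / 2) (at p within S)"
    by (intro tendsto_intros L x z) auto
  have H: "mean_curvature S N q = - (L q (x q) \<bullet> x q + L q (z q) \<bullet> z q) / 2"
    if "q \<in> V" "q \<in> S" "w q \<noteq> 0" for q
  proof -
    have n: "norm (N q) = 1" by (rule N_unit[OF that(2)])
    then have "N q \<bullet> w q = 0" by (simp add: w_def inner_diff_right inner_commute dot_square_norm)
    then have fx: "norm (x q) = 1" "N q \<bullet> x q = 0" using that(3) by (simp_all add: x_def)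
    from cross_frame[OF n fx] show ?thesis
      unfolding z_def by (intro mean_curvature_frame that fx)
  qed
  have "eventually (\<lambda>q. w q \<noteq> 0) (at p within S)"
    using tendsto_imp_eventually_ne[OF w, of 0] wp_nz by simp
  moreover have "eventually (\<lambda>q. q \<in> V) (at p within S)"
    using open_V p_V by (auto simp: eventually_at_topological)
  moreover have "eventually (\<lambda>q. q \<in> S) (at p within S)" by (auto simp: eventually_at_filter)
  ultimately have "eventually (\<lambda>q. - (L q (x q) \<bullet> x q + L q (z q) \<bullet> z q) / 2 = mean_curvature S N q) (at p within S)"
    by eventually_elim (use H in auto)
  from Lim_transform_eventually[OF lim this]
  show ?thesis unfolding continuous_within H[OF p_V p_S wp_nz] .
qed

lemma umbilic_L:
  assumes q: "q \<in> V" "q \<in> S" and "umbilic S N q" and v: "N q \<bullet> v = 0"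
  shows "L q v = - mean_curvature S N q *\<^sub>R v"
proof -
  obtain x y where fr: "norm x = 1" "norm y = 1" "x \<bullet> y = 0" "N q \<bullet> x = 0" "N q \<bullet> y = 0"
    using tangent_plane_frame[OF N_unit[OF q(2)]] by metis
  note frame = q fr(1,4,2,5,3)
  have um: "L q y \<bullet> y = L q x \<bullet> x" "L q x \<bullet> y = 0"
    using assms(3) umbilic_frame[OF frame] by auto
  have H: "L q x \<bullet> x = - mean_curvature S N q"
    using um(1) unfolding mean_curvature_frame[OF frame] by simp
  have "L q x = - mean_curvature S N q *\<^sub>R x" "L q y = - mean_curvature S N q *\<^sub>R y"
    using L_frame[OF frame] unfolding um H by simp_all
  then have "L q (a *\<^sub>R x + c *\<^sub>R y) = - mean_curvature S N q *\<^sub>R (a *\<^sub>R x + c *\<^sub>R y)" for a c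
    by (simp add: blinfun.add_right blinfun.scaleR_right scaleR_add_right mult.commute)
  moreover have "v = (v \<bullet> x) *\<^sub>R x + (v \<bullet> y) *\<^sub>R y"
    by (rule frame_expansion[OF N_unit[OF q(2)] fr v])
  ultimately show ?thesis by metis
qed

text \<open>In the umbilic neighbourhood the functions \<open>(N \<circ> R) \<bullet> e\<close> with \<open>e\<close> tangent at \<open>p\<close> have gradient
\<open>- (H \<circ> R) e\<close>: by the chain rule for \<open>N \<circ> R = N \<circ> R \<circ> R\<close>, where \<open>R \<bullet> e\<close> has gradient \<open>e\<close> because \<open>R\<close>
projects along \<open>N p\<close>. Comparing two orthogonal directions \<open>e\<close> shows that \<open>H \<circ> R\<close> is constant on a ball.\<close>

lemma umbilic_neighbourhood_mean_curvature:
  assumes T: "open T" "p \<in> T" and umb: "\<And>q. q \<in> S \<inter> T \<Longrightarrow> umbilic S N q"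
  obtains B where "open B" "p \<in> B" "\<And>q. q \<in> S \<inter> B \<Longrightarrow> mean_curvature S N q = mean_curvature S N p"
proof -
  have Rp: "R p = p" using R_id p_V p_S by simp
  have "isCont R p" by (rule has_derivative_continuous[OF dR[OF p_V]])
  then have "(R \<longlongrightarrow> R p) (nhds p)" by (simp only: isCont_def tendsto_at_iff_tendsto_nhds)
  moreover have "open (V \<inter> T)" "R p \<in> V \<inter> T" using open_V T p_V Rp by auto
  ultimately have "eventually (\<lambda>q. R q \<in> V \<inter> T) (nhds p)" by (rule topological_tendstoD)
  then obtain \<rho>1 where \<rho>1: "\<rho>1 > 0" "\<And>q. dist q p < \<rho>1 \<Longrightarrow> R q \<in> V \<inter> T"
    unfolding eventually_nhds_metric by blast
  obtain \<rho>2 where \<rho>2: "\<rho>2 > 0" "ball p \<rho>2 \<subseteq> V" using open_V p_V openE by blast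
  define \<rho> where "\<rho> = min \<rho>1 \<rho>2"
  have \<rho>: "\<rho> > 0" using \<rho>1 \<rho>2 by (simp add: \<rho>_def)
  define B where "B = ball p \<rho>"
  have BV: "q \<in> V" and RB: "R q \<in> V" "R q \<in> T" if "q \<in> B" for q
    using that \<rho>1(2)[of q] \<rho>2(2) by (auto simp: B_def \<rho>_def dist_commute)
  have B: "open B" "convex B" "p \<in> B" using \<rho> by (auto simp: B_def)
  define K where "K q = - mean_curvature S N (R q)" for q
  have dh: "((\<lambda>q. N (R q) \<bullet> e) has_derivative (\<lambda>z. K q * (z \<bullet> e))) (at q)"
    if e: "N p \<bullet> e = 0" and q: "q \<in> B" for e q
  proof -
    \<comment> \<open>\<open>R x\<close> is a point of \<open>S\<close> in \<open>V\<close>, hence fixed by \<open>R\<close>\<close>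
    have RR: "R (R x) = R x" if "x \<in> B" for x using R_id R_S BV RB that by blast
    have "((\<lambda>q. N (R (R q))) has_derivative (\<lambda>z. L (R q) (D q z))) (at q)"
      using has_derivative_compose[OF dR[OF BV[OF q]] dNR[OF RB(1)[OF q]]] .
    then have "((\<lambda>q. N (R q)) has_derivative (\<lambda>z. L (R q) (D q z))) (at q)"
      by (rule has_derivative_transform_within_open[OF _ B(1) q]) (simp add: RR)
    moreover have "L (R q) (D q z) = K q *\<^sub>R D q z" for z
      unfolding K_def using umbilic_L[OF RB(1)[OF q] R_S[OF BV[OF q]]] umb R_S[OF BV[OF q]] RB(2)[OF q] D_tangent[OF BV[OF q]]
      by simp
    ultimately have "((\<lambda>q. N (R q) \<bullet> e) has_derivative (\<lambda>z. (K q *\<^sub>R D q z) \<bullet> e)) (at q)"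
      by (intro has_derivative_inner_left) simp
    moreover have "D q z \<bullet> e = z \<bullet> e" for z
    proof -
      have "((\<lambda>q. R q \<bullet> e) has_derivative (\<lambda>z. D q z \<bullet> e)) (at q)"
        by (intro has_derivative_inner_left dR BV q)
      moreover have "((\<lambda>q. q \<bullet> e) has_derivative (\<lambda>z. z \<bullet> e)) (at q)"
        by (intro has_derivative_inner_left has_derivative_ident)
      then have "((\<lambda>q. R q \<bullet> e) has_derivative (\<lambda>z. z \<bullet> e)) (at q)"
        by (rule has_derivative_transform_within_open[OF _ B(1) q]) (simp add: R_inner[OF BV e])
      ultimately have "(\<lambda>z. D q z \<bullet> e) = (\<lambda>z. z \<bullet> e)" by (rule has_derivative_unique)
      then show ?thesis by (rule fun_cong)
    qed
    ultimately show ?thesis by simp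
  qed
  obtain e1 e2 where e: "norm e1 = 1" "norm e2 = 1" "e1 \<bullet> e2 = 0" "N p \<bullet> e1 = 0" "N p \<bullet> e2 = 0"
    using tangent_plane_frame[OF N_unit[OF p_S]] by metis
  have K_const: "K q = K p" if q: "q \<in> B" for q
  proof -
    \<comment> \<open>\<open>m\<close> has the same \<open>e1\<close>-coordinate as \<open>q\<close> and the same \<open>e2\<close>-coordinate as \<open>p\<close>\<close>
    define m where "m = p + ((q - p) \<bullet> e1) *\<^sub>R e1"
    have "norm (m - p) \<le> norm (q - p)"
      using Cauchy_Schwarz_ineq2[of "q - p" e1] e(1) by (simp add: m_def)
    then have m: "m \<in> B" using q by (simp add: B_def dist_norm norm_minus_commute)
    have "(m - q) \<bullet> e1 = 0" using e(1) by (simp add: m_def inner_add_left inner_diff_left dot_square_norm)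
    from slope_constant_across[OF B(1,2) e(1) dh[OF e(4)] q m this]
    have "K q = K m" .
    moreover have "(p - m) \<bullet> e2 = 0" using e(3) by (simp add: m_def)
    from slope_constant_across[OF B(1,2) e(2) dh[OF e(5)] m B(3) this]
    have "K m = K p" .
    ultimately show ?thesis by simp
  qed
  have "mean_curvature S N q = mean_curvature S N p" if q: "q \<in> S \<inter> B" for q
  proof -
    have "R q = q" using q R_id BV by blast
    then show ?thesis using K_const[of q] q Rp by (simp add: K_def)
  qed
  with B show thesis using that by blast
qed

end

section \<open>Constant mean curvature\<close>

theorem corollary1p3:
  fixes S :: "(real^3) set" and N :: "real^3 \<Rightarrow> real^3"
  assumes "C2_surface S" and "connected S" and "unit_normal_field S N"
    and "\<not> totally_umbilic S N"
  shows "(\<exists>H. H \<noteq> 0 \<and> (\<forall>p\<in>S. mean_curvature S N p = H)) \<longleftrightarrow>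
    (\<exists>r. r \<noteq> 0 \<and> (\<forall>p\<in>S. \<not> umbilic S N p \<longrightarrow> rolls_isotropically S N r p))"
proof -
  let ?H = "mean_curvature S N"
  have patch: "\<exists>V R D L. surface_patch S N p V R D L" if "p \<in> S" for p
    using surface_patch_exists[OF assms(1,3) that] by metis
  have iso: "rolls_isotropically S N r p \<longleftrightarrow> r * ?H p = 1"
    if "p \<in> S" "\<not> umbilic S N p" "r \<noteq> 0" for p r
    using patch[OF that(1)] surface_patch.rolls_isotropically_iff that(2,3) by blast
  have cont: "continuous_on S ?H"
    unfolding continuous_on_eq_continuous_within
    using patch surface_patch.continuous_mean_curvature by blast
  show ?thesis
  proof
    assume "\<exists>H. H \<noteq> 0 \<and> (\<forall>p\<in>S. ?H p = H)"
    then obtain H where H: "H \<noteq> 0" "\<And>p. p \<in> S \<Longrightarrow> ?H p = H" by blast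
    show "\<exists>r. r \<noteq> 0 \<and> (\<forall>p\<in>S. \<not> umbilic S N p \<longrightarrow> rolls_isotropically S N r p)"
    proof (intro exI[of _ "1 / H"] conjI ballI impI)
      show "1 / H \<noteq> 0" using H(1) by simp
      fix p assume "p \<in> S" "\<not> umbilic S N p"
      then show "rolls_isotropically S N (1 / H) p" using iso[of p "1 / H"] H by simp
    qed
  next
    assume "\<exists>r. r \<noteq> 0 \<and> (\<forall>p\<in>S. \<not> umbilic S N p \<longrightarrow> rolls_isotropically S N r p)"
    then obtain r where r: "r \<noteq> 0" "\<And>p. p \<in> S \<Longrightarrow> \<not> umbilic S N p \<Longrightarrow> rolls_isotropically S N r p" by blast
    have nonumb: "?H p = 1 / r" if "p \<in> S" "\<not> umbilic S N p" for p
      using iso[OF that r(1)] r that by (simp add: field_simps)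
    have "?H p = 1 / r" if p: "p \<in> S" for p
    proof (rule ccontr)
      assume ne: "?H p \<noteq> 1 / r"
      define Z where "Z = {q \<in> S. ?H q = ?H p}"
      have "closedin (top_of_set S) Z"
        unfolding Z_def by (rule continuous_closedin_preimage_constant[OF cont])
      moreover have "openin (top_of_set S) Z"
      proof (subst openin_subopen, intro ballI)
        fix q assume "q \<in> Z"
        then have q: "q \<in> S" "?H q = ?H p" by (auto simp: Z_def)
        have "openin (top_of_set S) (S \<inter> ?H -` (- {1 / r}))"
          by (intro continuous_openin_preimage_gen cont) auto
        then obtain T where T: "open T" "S \<inter> ?H -` (- {1 / r}) = S \<inter> T" unfolding openin_open by blast
        have "q \<in> T" using T(2) q ne by auto
        have "umbilic S N x" if "x \<in> S \<inter> T" for x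
          using that T(2) nonumb by blast
        with T(1) \<open>q \<in> T\<close> obtain B where B: "open B" "q \<in> B" "\<And>x. x \<in> S \<inter> B \<Longrightarrow> ?H x = ?H q"
          using patch[OF q(1)] surface_patch.umbilic_neighbourhood_mean_curvature by metis
        then show "\<exists>T. openin (top_of_set S) T \<and> q \<in> T \<and> T \<subseteq> Z"
          using q by (intro exI[of _ "S \<inter> B"]) (auto simp: Z_def openin_open)
      qed
      ultimately have "Z = {} \<or> Z = S" using assms(2) connected_clopen by blast
      then have "Z = S" using p by (auto simp: Z_def)
      then have "?H x \<noteq> 1 / r" if "x \<in> S" for x
      proof -
        have "x \<in> Z" using that \<open>Z = S\<close> by simp
        then show ?thesis using ne by (simp add: Z_def)
      qed
      then have "totally_umbilic S N" unfolding totally_umbilic_def using nonumb by blast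
      with assms(4) show False by simp
    qed
    then show "\<exists>H. H \<noteq> 0 \<and> (\<forall>p\<in>S. ?H p = H)" using r(1) by (intro exI[of _ "1 / r"]) auto
  qed
qed

end
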